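(* Let $R$ be a commutative ring with identity, and let $T=\{a\in R \mid R_a \text{ has stable range 1}\}$. If the localization $R_T=T^{-1}R$ has adequate range 1, then $R$ is an elementary divisor ring if and only if $R$ is a Hermite ring.
   Context: All rings are commutative with identity; $U(R)$ is the unit group of $R$. For $a\in R$ put $S_a=\{b\in R \mid aR+bR=R\}$, a multiplicatively closed set, and $R_a=S_a^{-1}R$ (the localization of $R$ at $S_a$; this is not the localization at the powers of $a$). A ring $R$ has stable range 1 if whenever $cR+dR=R$ with $c,d\in R$, there is $y\in R$ with $c+dy\in U(R)$. The set $T$ is a multiplicatively closed subset of $R$. An element $c$ of a ring $R$ is adequate if for every $a\in R$ there exist $r,s\in R$ such that (1) $c=rs$; (2) $rR+aR=R$; (3) $s'R+aR\neq R$ for each non-invertible divisor $s'$ of $s$. A ring $R$ has adequate range 1 if whenever $aR+bR=R$ with $a,b\in R$, there is $y\in R$ such that $a+by$ is adequate in $R$. A (not necessarily square) matrix $A$ over $R$ admits a diagonal reduction if there are invertible matrices $P,Q$ such that $PAQ=(\varepsilon_{ij})$ is a diagonal matrix with $\varepsilon_{ii}$ dividing $\varepsilon_{(i+1)(i+1)}$ for each $i$. $R$ is an elementary divisor ring if every matrix over $R$ admits a diagonal reduction. $R$ is a Hermite ring if for any $a,b\in R$ there is $Q\in GL_2(R)$ such that $(a,b)Q=(c,0)$ for some $c\in R$. *)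

theory Defs
  imports "HOL-Algebra.Divisibility" "HOL-Algebra.Ideal"
begin

section \<open>Localization at a multiplicatively closed set\<close>

definition fraction_rel :: "('a, 'm) ring_scheme \<Rightarrow> 'a set \<Rightarrow> (('a \<times> 'a) \<times> ('a \<times> 'a)) set" where
  "fraction_rel R S = {((a, s), (b, t)). a \<in> carrier R \<and> s \<in> S \<and> b \<in> carrier R \<and> t \<in> S \<and>
     (\<exists>u\<in>S. u \<otimes>\<^bsub>R\<^esub> (a \<otimes>\<^bsub>R\<^esub> t \<ominus>\<^bsub>R\<^esub> b \<otimes>\<^bsub>R\<^esub> s) = \<zero>\<^bsub>R\<^esub>)}"

definition fraction :: "('a, 'm) ring_scheme \<Rightarrow> 'a set \<Rightarrow> 'a \<Rightarrow> 'a \<Rightarrow> ('a \<times> 'a) set" where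
  "fraction R S a s = fraction_rel R S `` {(a, s)}"

(* The set S may contain zero divisors, or zero itself; in the latter case the result is the
   zero ring.  The operations on classes are unions over all representatives, as is usual for
   quotients; for multiplicatively closed S all the sets in the union coincide (see below). *)
definition localization :: "('a, 'm) ring_scheme \<Rightarrow> 'a set \<Rightarrow> ('a \<times> 'a) set ring" where
  "localization R S =
    \<lparr>carrier = (carrier R \<times> S) // fraction_rel R S,
     mult = (\<lambda>A B. \<Union>(a, s)\<in>A. \<Union>(b, t)\<in>B. fraction R S (a \<otimes>\<^bsub>R\<^esub> b) (s \<otimes>\<^bsub>R\<^esub> t)),
     one = fraction R S \<one>\<^bsub>R\<^esub> \<one>\<^bsub>R\<^esub>,
     zero = fraction R S \<zero>\<^bsub>R\<^esub> \<one>\<^bsub>R\<^esub>,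
     add = (\<lambda>A B. \<Union>(a, s)\<in>A. \<Union>(b, t)\<in>B.
       fraction R S (a \<otimes>\<^bsub>R\<^esub> t \<oplus>\<^bsub>R\<^esub> b \<otimes>\<^bsub>R\<^esub> s) (s \<otimes>\<^bsub>R\<^esub> t))\<rparr>"

locale mult_closed = cring R for R (structure) +
  fixes S
  assumes S_sub: "S \<subseteq> carrier R"
    and one_S: "\<one> \<in> S"
    and mult_S: "\<lbrakk>s \<in> S; t \<in> S\<rbrakk> \<Longrightarrow> s \<otimes> t \<in> S"
begin

lemma S_closed: "s \<in> S \<Longrightarrow> s \<in> carrier R"
  using S_sub by blast

lemma fraction_rel_iff:
  "((a, s), (b, t)) \<in> fraction_rel R S \<longleftrightarrow>
    a \<in> carrier R \<and> s \<in> S \<and> b \<in> carrier R \<and> t \<in> S \<and>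
    (\<exists>u\<in>S. u \<otimes> (a \<otimes> t) = u \<otimes> (b \<otimes> s))"
proof -
  have "(u \<otimes> (a \<otimes> t \<ominus> b \<otimes> s) = \<zero>) = (u \<otimes> (a \<otimes> t) = u \<otimes> (b \<otimes> s))"
    if "u \<in> S" "a \<in> carrier R" "s \<in> S" "b \<in> carrier R" "t \<in> S" for u
  proof -
    have "u \<otimes> (a \<otimes> t \<ominus> b \<otimes> s) = u \<otimes> (a \<otimes> t) \<ominus> u \<otimes> (b \<otimes> s)"
      using that S_closed by (simp add: minus_eq r_distr r_minus)
    moreover have "(x \<ominus> y = \<zero>) = (x = y)" if "x \<in> carrier R" "y \<in> carrier R" for x y
      using that by (metis add.inv_closed add.inv_solve_right' l_zero minus_eq zero_closed)
    ultimately show ?thesis using that S_closed by simp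
  qed
  then show ?thesis unfolding fraction_rel_def by auto
qed

lemma equiv_fraction_rel: "equiv (carrier R \<times> S) (fraction_rel R S)"
proof (rule equivI)
  show "fraction_rel R S \<subseteq> (carrier R \<times> S) \<times> (carrier R \<times> S)"
    by (auto simp: fraction_rel_def)
  show "refl_on (carrier R \<times> S) (fraction_rel R S)"
    unfolding refl_on_def using one_S by (auto simp: fraction_rel_iff)
  show "sym (fraction_rel R S)"
    unfolding sym_def by (auto simp: fraction_rel_iff) metis+
  show "trans (fraction_rel R S)"
  proof (rule transI, clarify)
    fix a s b t c v
    assume "((a, s), (b, t)) \<in> fraction_rel R S" "((b, t), (c, v)) \<in> fraction_rel R S"
    then obtain u w where h: "a \<in> carrier R" "s \<in> S" "b \<in> carrier R" "t \<in> S" "c \<in> carrier R"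
      "v \<in> S" "u \<in> S" "w \<in> S" "u \<otimes> (a \<otimes> t) = u \<otimes> (b \<otimes> s)" "w \<otimes> (b \<otimes> v) = w \<otimes> (c \<otimes> t)"
      by (auto simp: fraction_rel_iff)
    then have c: "s \<in> carrier R" "t \<in> carrier R" "v \<in> carrier R" "u \<in> carrier R" "w \<in> carrier R"
      using S_closed by auto
    have "(u \<otimes> w \<otimes> t) \<otimes> (a \<otimes> v) = (w \<otimes> v) \<otimes> (u \<otimes> (a \<otimes> t))" using h(1,3,5) c by (simp add: m_ac l_distr r_distr)
    also have "\<dots> = (u \<otimes> s) \<otimes> (w \<otimes> (b \<otimes> v))" unfolding h(9) using h(1,3,5) c by (simp add: m_ac l_distr r_distr)
    also have "\<dots> = (u \<otimes> w \<otimes> t) \<otimes> (c \<otimes> s)" unfolding h(10) using h(1,3,5) c by (simp add: m_ac l_distr r_distr)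
    finally show "((a, s), (c, v)) \<in> fraction_rel R S"
      unfolding fraction_rel_iff using h(1,2,5,6) mult_S[OF mult_S[OF h(7,8)] h(4)] by blast
  qed
qed

lemma mem_fraction_iff: "(b, t) \<in> fraction R S a s \<longleftrightarrow> ((a, s), (b, t)) \<in> fraction_rel R S"
  by (simp add: fraction_def)

lemma fraction_eq_iff:
  assumes "a \<in> carrier R" "s \<in> S" "b \<in> carrier R" "t \<in> S"
  shows "fraction R S a s = fraction R S b t \<longleftrightarrow> (\<exists>u\<in>S. u \<otimes> (a \<otimes> t) = u \<otimes> (b \<otimes> s))"
  unfolding fraction_def
  using assms by (subst eq_equiv_class_iff[OF equiv_fraction_rel]) (auto simp: fraction_rel_iff)

lemma localization_mult_fraction:
  assumes h: "a \<in> carrier R" "s \<in> S" "b \<in> carrier R" "t \<in> S"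
  shows "fraction R S a s \<otimes>\<^bsub>localization R S\<^esub> fraction R S b t = fraction R S (a \<otimes> b) (s \<otimes> t)"
proof -
  have "fraction R S (a' \<otimes> b') (s' \<otimes> t') = fraction R S (a \<otimes> b) (s \<otimes> t)"
    if 1: "((a, s), (a', s')) \<in> fraction_rel R S" and 2: "((b, t), (b', t')) \<in> fraction_rel R S"
    for a' s' b' t'
  proof -
    obtain u w where k: "a' \<in> carrier R" "s' \<in> S" "b' \<in> carrier R" "t' \<in> S" "u \<in> S" "w \<in> S"
      "u \<otimes> (a \<otimes> s') = u \<otimes> (a' \<otimes> s)" "w \<otimes> (b \<otimes> t') = w \<otimes> (b' \<otimes> t)"
      using 1 2 by (auto simp: fraction_rel_iff)
    have c: "s \<in> carrier R" "t \<in> carrier R" "s' \<in> carrier R" "t' \<in> carrier R" "u \<in> carrier R"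
      "w \<in> carrier R" using h k S_closed by auto
    have "(u \<otimes> w) \<otimes> ((a' \<otimes> b') \<otimes> (s \<otimes> t)) = (u \<otimes> (a' \<otimes> s)) \<otimes> (w \<otimes> (b' \<otimes> t))"
      using h(1,3) k(1,3) c by (simp add: m_ac l_distr r_distr)
    also have "\<dots> = (u \<otimes> w) \<otimes> ((a \<otimes> b) \<otimes> (s' \<otimes> t'))"
      unfolding k(7,8)[symmetric] using h(1,3) k(1,3) c by (simp add: m_ac l_distr r_distr)
    finally show ?thesis
      using mult_S[OF k(5,6)] h(1,3) k(1,3) mult_S[OF k(2,4)] mult_S[OF h(2,4)]
      by (subst fraction_eq_iff) auto
  qed
  note * = this
  have mem: "(a, s) \<in> fraction R S a s" "(b, t) \<in> fraction R S b t"
    using h one_S by (auto simp: fraction_def fraction_rel_iff)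
  have "(\<Union>(b', t')\<in>fraction R S b t. fraction R S (a' \<otimes> b') (s' \<otimes> t')) =
      fraction R S (a \<otimes> b) (s \<otimes> t)" if "(a', s') \<in> fraction R S a s" for a' s'
    by (rule UN_constant_eq[OF mem(2)]) (use * that in \<open>auto simp: mem_fraction_iff\<close>)
  then have "(\<Union>(a', s')\<in>fraction R S a s. \<Union>(b', t')\<in>fraction R S b t.
      fraction R S (a' \<otimes> b') (s' \<otimes> t')) = fraction R S (a \<otimes> b) (s \<otimes> t)"
    by (intro UN_constant_eq[OF mem(1)]) auto
  then show ?thesis by (simp add: localization_def)
qed

lemma localization_add_fraction:
  assumes h: "a \<in> carrier R" "s \<in> S" "b \<in> carrier R" "t \<in> S"
  shows "fraction R S a s \<oplus>\<^bsub>localization R S\<^esub> fraction R S b t =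
    fraction R S (a \<otimes> t \<oplus> b \<otimes> s) (s \<otimes> t)"
proof -
  have "fraction R S (a' \<otimes> t' \<oplus> b' \<otimes> s') (s' \<otimes> t') = fraction R S (a \<otimes> t \<oplus> b \<otimes> s) (s \<otimes> t)"
    if 1: "((a, s), (a', s')) \<in> fraction_rel R S" and 2: "((b, t), (b', t')) \<in> fraction_rel R S"
    for a' s' b' t'
  proof -
    obtain u w where k: "a' \<in> carrier R" "s' \<in> S" "b' \<in> carrier R" "t' \<in> S" "u \<in> S" "w \<in> S"
      "u \<otimes> (a \<otimes> s') = u \<otimes> (a' \<otimes> s)" "w \<otimes> (b \<otimes> t') = w \<otimes> (b' \<otimes> t)"
      using 1 2 by (auto simp: fraction_rel_iff)
    have c: "s \<in> carrier R" "t \<in> carrier R" "s' \<in> carrier R" "t' \<in> carrier R" "u \<in> carrier R"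
      "w \<in> carrier R" using h k S_closed by auto
    have "(u \<otimes> w) \<otimes> ((a' \<otimes> t' \<oplus> b' \<otimes> s') \<otimes> (s \<otimes> t)) =
        (w \<otimes> t \<otimes> t') \<otimes> (u \<otimes> (a' \<otimes> s)) \<oplus> (u \<otimes> s \<otimes> s') \<otimes> (w \<otimes> (b' \<otimes> t))"
      using h(1,3) k(1,3) c by (simp add: m_ac l_distr r_distr)
    also have "\<dots> = (u \<otimes> w) \<otimes> ((a \<otimes> t \<oplus> b \<otimes> s) \<otimes> (s' \<otimes> t'))"
      unfolding k(7,8)[symmetric] using h(1,3) k(1,3) c by (simp add: m_ac l_distr r_distr)
    finally show ?thesis
      using mult_S[OF k(5,6)] h(1,3) k(1,3) c mult_S[OF k(2,4)] mult_S[OF h(2,4)]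
      by (subst fraction_eq_iff) auto
  qed
  note * = this
  have mem: "(a, s) \<in> fraction R S a s" "(b, t) \<in> fraction R S b t"
    using h one_S by (auto simp: fraction_def fraction_rel_iff)
  have "(\<Union>(b', t')\<in>fraction R S b t. fraction R S (a' \<otimes> t' \<oplus> b' \<otimes> s') (s' \<otimes> t')) =
      fraction R S (a \<otimes> t \<oplus> b \<otimes> s) (s \<otimes> t)" if "(a', s') \<in> fraction R S a s" for a' s'
    by (rule UN_constant_eq[OF mem(2)]) (use * that in \<open>auto simp: mem_fraction_iff\<close>)
  then have "(\<Union>(a', s')\<in>fraction R S a s. \<Union>(b', t')\<in>fraction R S b t.
      fraction R S (a' \<otimes> t' \<oplus> b' \<otimes> s') (s' \<otimes> t')) = fraction R S (a \<otimes> t \<oplus> b \<otimes> s) (s \<otimes> t)"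
    by (intro UN_constant_eq[OF mem(1)]) auto
  then show ?thesis by (simp add: localization_def)
qed

end


section \<open>Stable range and adequate range\<close>

definition comaximal :: "('a, 'm) ring_scheme \<Rightarrow> 'a \<Rightarrow> 'a \<Rightarrow> bool" where
  "comaximal R a b \<longleftrightarrow> (PIdl\<^bsub>R\<^esub> a) <+>\<^bsub>R\<^esub> (PIdl\<^bsub>R\<^esub> b) = carrier R"

definition stable_range_1 :: "('a, 'm) ring_scheme \<Rightarrow> bool" where
  "stable_range_1 R \<longleftrightarrow>
    (\<forall>c\<in>carrier R. \<forall>d\<in>carrier R. comaximal R c d \<longrightarrow>
      (\<exists>y\<in>carrier R. c \<oplus>\<^bsub>R\<^esub> d \<otimes>\<^bsub>R\<^esub> y \<in> Units R))"

definition adequate :: "('a, 'm) ring_scheme \<Rightarrow> 'a \<Rightarrow> bool" where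
  "adequate R c \<longleftrightarrow>
    (\<forall>a\<in>carrier R. \<exists>r\<in>carrier R. \<exists>s\<in>carrier R.
      c = r \<otimes>\<^bsub>R\<^esub> s \<and>
      comaximal R r a \<and>
      (\<forall>s'\<in>carrier R. s' divides\<^bsub>R\<^esub> s \<and> s' \<notin> Units R \<longrightarrow> \<not> comaximal R s' a))"

definition adequate_range_1 :: "('a, 'm) ring_scheme \<Rightarrow> bool" where
  "adequate_range_1 R \<longleftrightarrow>
    (\<forall>a\<in>carrier R. \<forall>b\<in>carrier R. comaximal R a b \<longrightarrow>
      (\<exists>y\<in>carrier R. adequate R (a \<oplus>\<^bsub>R\<^esub> b \<otimes>\<^bsub>R\<^esub> y)))"

definition comaximal_set :: "('a, 'm) ring_scheme \<Rightarrow> 'a \<Rightarrow> 'a set" where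
  "comaximal_set R a = {b \<in> carrier R. comaximal R a b}"

definition loc_stable_range_1_set :: "('a, 'm) ring_scheme \<Rightarrow> 'a set" where
  "loc_stable_range_1_set R =
    {a \<in> carrier R. stable_range_1 (localization R (comaximal_set R a))}"


section \<open>Matrices, elementary divisor rings, Hermite rings\<close>

(* An m x n matrix is a function of two indices, of which only the entries A i j with
   i < m and j < n are meaningful; matrix equalities are stated for those entries only. *)
definition matrices :: "('a, 'm) ring_scheme \<Rightarrow> nat \<Rightarrow> nat \<Rightarrow> (nat \<Rightarrow> nat \<Rightarrow> 'a) set" where
  "matrices R m n = {A. \<forall>i<m. \<forall>j<n. A i j \<in> carrier R}"

(* k is the number of columns of A and of rows of B *)
definition matrix_mult ::
  "('a, 'm) ring_scheme \<Rightarrow> nat \<Rightarrow> (nat \<Rightarrow> nat \<Rightarrow> 'a) \<Rightarrow> (nat \<Rightarrow> nat \<Rightarrow> 'a) \<Rightarrow> nat \<Rightarrow> nat \<Rightarrow> 'a" where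
  "matrix_mult R k A B = (\<lambda>i j. \<Oplus>\<^bsub>R\<^esub>l\<in>{..<k}. A i l \<otimes>\<^bsub>R\<^esub> B l j)"

definition general_linear :: "('a, 'm) ring_scheme \<Rightarrow> nat \<Rightarrow> (nat \<Rightarrow> nat \<Rightarrow> 'a) set" where
  "general_linear R n = {P \<in> matrices R n n. \<exists>P'\<in>matrices R n n. \<forall>i<n. \<forall>j<n.
     matrix_mult R n P P' i j = (if i = j then \<one>\<^bsub>R\<^esub> else \<zero>\<^bsub>R\<^esub>) \<and>
     matrix_mult R n P' P i j = (if i = j then \<one>\<^bsub>R\<^esub> else \<zero>\<^bsub>R\<^esub>)}"

definition admits_diagonal_reduction ::
  "('a, 'm) ring_scheme \<Rightarrow> nat \<Rightarrow> nat \<Rightarrow> (nat \<Rightarrow> nat \<Rightarrow> 'a) \<Rightarrow> bool" where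
  "admits_diagonal_reduction R m n A \<longleftrightarrow>
    (\<exists>P\<in>general_linear R m. \<exists>Q\<in>general_linear R n.
      let E = matrix_mult R n (matrix_mult R m P A) Q in
        (\<forall>i<m. \<forall>j<n. i \<noteq> j \<longrightarrow> E i j = \<zero>\<^bsub>R\<^esub>) \<and>
        (\<forall>i. i + 1 < min m n \<longrightarrow> E i i divides\<^bsub>R\<^esub> E (i + 1) (i + 1)))"

definition elementary_divisor_ring :: "('a, 'm) ring_scheme \<Rightarrow> bool" where
  "elementary_divisor_ring R \<longleftrightarrow>
    (\<forall>m n. \<forall>A\<in>matrices R m n. admits_diagonal_reduction R m n A)"

definition hermite_ring :: "('a, 'm) ring_scheme \<Rightarrow> bool" where
  "hermite_ring R \<longleftrightarrow>
    (\<forall>a\<in>carrier R. \<forall>b\<in>carrier R. \<exists>Q\<in>general_linear R 2. \<exists>c\<in>carrier R.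
      let row = (\<lambda>i j. if j = 0 then a else b); E = matrix_mult R 2 row Q in
        E 0 0 = c \<and> E 0 1 = \<zero>\<^bsub>R\<^esub>)"

end

(* Write p A q for the value of the bilinear form of a matrix A at a row p and a column q.  If a 2 x 2
   matrix A over a Hermite ring has comaximal entries and p A q = e with p unimodular and R/eR of
   stable range 1, then 1 is also a value of A: extending p and q to invertible matrices makes A
   lower triangular with a divisor of e in the corner, and stable range 1 modulo that divisor
   produces a unimodular column.  Since a in T means that R/aR has stable range 1, and adequate
   elements of Hermite rings have this property, adequate range 1 of T^-1 R gives the value 1 over
   T^-1 R.  Clearing denominators gives a value t in T over R, and dividing out the content of p
   allows the first argument to be used again, now over R.

   Hence every 2 x 2 matrix has a value dividing all its entries.  Induction on the size extends
   this to all matrices; over a Hermite ring such a value can be moved to the upper left corner up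
   to a factor, after which the first row and column can be cleared. *)

theory Submission
  imports Defs
begin

section \<open>Stable range 1 modulo an element\<close>

text \<open>Only \<open>p\<close> has to be unimodular; \<open>q\<close> stays arbitrary. Once
  \<open>p\<close> is completed to an invertible matrix, the gcd \<open>w\<close> of the new first
  row divides the value \<open>e\<close>, and \<open>stable_mod\<close> passes from an element to
  its divisors, since \<open>R/wR\<close> is a quotient of \<open>R/eR\<close>. So the corner is
  controlled although nothing else is known about \<open>e\<close>.

  The second pass is forced because elements of T need not be units of \<open>R\<close>: clearing
  denominators turns the value 1 into an element of T and multiplies the row by denominators, which
  can destroy its unimodularity. Closure of T under products makes the fractions available; closure
  under divisors lets the value survive division by the content of the row.

  The rings \<open>R_a\<close> enter only through \<open>stable_mod\<close>. The set S_a consists of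
  the elements invertible modulo \<open>a\<close>, so \<open>a\<close> lies in the Jacobson radical
  of \<open>R_a\<close>, and \<open>R_a\<close> modulo \<open>a\<close> is \<open>R/aR\<close>.
  Identities inside the ring replace quotient rings, so the same lemmas apply to \<open>R\<close>
  and to its localization at T.\<close>

text \<open>An elementwise form of: the quotient \<open>R/aR\<close> has stable range 1.\<close>

definition stable_mod :: "('a, 'm) ring_scheme \<Rightarrow> 'a \<Rightarrow> bool" where
  "stable_mod R a \<longleftrightarrow>
    (\<forall>c\<in>carrier R. \<forall>d\<in>carrier R.
      (\<exists>x\<in>carrier R. \<exists>y\<in>carrier R. \<exists>z\<in>carrier R.
        c \<otimes>\<^bsub>R\<^esub> x \<oplus>\<^bsub>R\<^esub> d \<otimes>\<^bsub>R\<^esub> y \<oplus>\<^bsub>R\<^esub> a \<otimes>\<^bsub>R\<^esub> z = \<one>\<^bsub>R\<^esub>) \<longrightarrow>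
      (\<exists>k\<in>carrier R. comaximal R (c \<oplus>\<^bsub>R\<^esub> d \<otimes>\<^bsub>R\<^esub> k) a))"

context cring
begin

lemma comaximal_iff:
  assumes "a \<in> carrier R" "b \<in> carrier R"
  shows "comaximal R a b \<longleftrightarrow> (\<exists>x\<in>carrier R. \<exists>y\<in>carrier R. a \<otimes> x \<oplus> b \<otimes> y = \<one>)"
proof -
  have "ideal (PIdl a <+> PIdl b) R"
    by (intro add_ideals cgenideal_ideal assms)
  then have "comaximal R a b \<longleftrightarrow> \<one> \<in> PIdl a <+> PIdl b"
    unfolding comaximal_def by (metis ideal.one_imp_carrier one_closed)
  also have "\<dots> \<longleftrightarrow> (\<exists>x\<in>carrier R. \<exists>y\<in>carrier R. x \<otimes> a \<oplus> y \<otimes> b = \<one>)"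
    unfolding set_add_def' cgenideal_def by fastforce
  finally show ?thesis
    using assms by (metis m_comm)
qed

lemma comaximal_sym:
  assumes "a \<in> carrier R" "b \<in> carrier R" "comaximal R a b"
  shows "comaximal R b a"
proof -
  obtain x y where "x \<in> carrier R" "y \<in> carrier R" "a \<otimes> x \<oplus> b \<otimes> y = \<one>"
    using assms by (auto simp: comaximal_iff)
  then show ?thesis
    using assms unfolding comaximal_iff[OF assms(2,1)]
    by (metis a_comm m_closed)
qed

text \<open>In the product of the two Bezout identities every term except \<open>b y c w\<close>
  contains \<open>a\<close>.\<close>

lemma comaximal_mult:
  assumes "a \<in> carrier R" "b \<in> carrier R" "c \<in> carrier R" "comaximal R a b" "comaximal R a c"
  shows "comaximal R a (b \<otimes> c)"
proof -
  obtain x y where 1: "x \<in> carrier R" "y \<in> carrier R" "a \<otimes> x \<oplus> b \<otimes> y = \<one>"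
    using assms by (auto simp: comaximal_iff)
  obtain v w where 2: "v \<in> carrier R" "w \<in> carrier R" "a \<otimes> v \<oplus> c \<otimes> w = \<one>"
    using assms by (auto simp: comaximal_iff)
  have "a \<otimes> (x \<otimes> (a \<otimes> v \<oplus> c \<otimes> w) \<oplus> b \<otimes> y \<otimes> v) \<oplus> (b \<otimes> c) \<otimes> (y \<otimes> w)
      = (a \<otimes> x \<oplus> b \<otimes> y) \<otimes> (a \<otimes> v \<oplus> c \<otimes> w)"
    using assms(1-3) 1(1,2) 2(1,2) by algebra
  then have "a \<otimes> (x \<otimes> (a \<otimes> v \<oplus> c \<otimes> w) \<oplus> b \<otimes> y \<otimes> v) \<oplus> (b \<otimes> c) \<otimes> (y \<otimes> w) = \<one>"
    using 1(3) 2(3) by simp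
  then show ?thesis
    using assms 1(1,2) 2(1,2) by (subst comaximal_iff) (auto intro!: bexI)
qed

lemma comaximal_factor:
  assumes "a \<in> carrier R" "b \<in> carrier R" "c \<in> carrier R" "comaximal R a (b \<otimes> c)"
  shows "comaximal R a b"
proof -
  obtain x y where "x \<in> carrier R" "y \<in> carrier R" "a \<otimes> x \<oplus> b \<otimes> c \<otimes> y = \<one>"
    using assms by (auto simp: comaximal_iff)
  then show ?thesis
    using assms unfolding comaximal_iff[OF assms(1,2)] by (metis m_assoc m_closed)
qed

lemma comaximal_add:
  assumes "a \<in> carrier R" "b \<in> carrier R" "c \<in> carrier R" "comaximal R a b"
  shows "comaximal R (a \<oplus> b \<otimes> c) b"
proof -
  obtain x y where 1: "x \<in> carrier R" "y \<in> carrier R" "a \<otimes> x \<oplus> b \<otimes> y = \<one>"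
    using assms by (auto simp: comaximal_iff)
  have "(a \<oplus> b \<otimes> c) \<otimes> x \<oplus> b \<otimes> (y \<ominus> c \<otimes> x) = a \<otimes> x \<oplus> b \<otimes> y"
    using assms(1-3) 1(1,2) by algebra
  then show ?thesis
    using assms 1 unfolding comaximal_iff[OF a_closed[OF assms(1) m_closed[OF assms(2,3)]] assms(2)]
    by (metis m_closed minus_closed)
qed

lemma stable_modD:
  assumes "stable_mod R a" "c \<in> carrier R" "d \<in> carrier R"
    "x \<in> carrier R" "y \<in> carrier R" "z \<in> carrier R" "c \<otimes> x \<oplus> d \<otimes> y \<oplus> a \<otimes> z = \<one>"
  obtains k where "k \<in> carrier R" "comaximal R (c \<oplus> d \<otimes> k) a"
  using assms(1)[unfolded stable_mod_def, rule_format, OF assms(2,3)] assms(4-7) by blast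

lemma stable_mod_one: "stable_mod R \<one>"
  unfolding stable_mod_def
proof (intro ballI impI bexI[of _ \<zero>])
  fix c d assume "c \<in> carrier R" "d \<in> carrier R"
  then have "(c \<oplus> d \<otimes> \<zero>) \<otimes> \<zero> \<oplus> \<one> \<otimes> \<one> = \<one>" by simp
  then show "comaximal R (c \<oplus> d \<otimes> \<zero>) \<one>"
    using \<open>c \<in> carrier R\<close> \<open>d \<in> carrier R\<close> by (subst comaximal_iff) blast+
qed simp

lemma stable_mod_mult:
  assumes ab: "a \<in> carrier R" "b \<in> carrier R" and sa: "stable_mod R a" and sb: "stable_mod R b"
  shows "stable_mod R (a \<otimes> b)"
  unfolding stable_mod_def
proof (intro ballI impI, elim bexE)
  fix c d x y z assume c: "c \<in> carrier R" "d \<in> carrier R" "x \<in> carrier R" "y \<in> carrier R" "z \<in> carrier R"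
    and e: "c \<otimes> x \<oplus> d \<otimes> y \<oplus> a \<otimes> b \<otimes> z = \<one>"
  have "c \<otimes> x \<oplus> d \<otimes> y \<oplus> a \<otimes> (b \<otimes> z) = \<one>" using e c ab by (simp add: m_assoc)
  then obtain k where k: "k \<in> carrier R" "comaximal R (c \<oplus> d \<otimes> k) a"
    using stable_modD[OF sa c(1-4) m_closed[OF ab(2) c(5)]] by blast
  define f where "f = c \<oplus> d \<otimes> k"
  define n where "n = y \<ominus> k \<otimes> x"
  have f: "f \<in> carrier R" and n: "n \<in> carrier R" using c k by (auto simp: f_def n_def)
  obtain p q where pq: "p \<in> carrier R" "q \<in> carrier R" "f \<otimes> p \<oplus> a \<otimes> q = \<one>"
    using c ab k by (auto simp: comaximal_iff f_def)
  \<comment> \<open>The pair \<open>f\<close>, \<open>d a\<close> still generates the unit ideal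
    modulo \<open>b\<close>: inserting \<open>f p + a q = 1\<close> into the term \<open>d n\<close>
    splits it into a multiple of \<open>f\<close> and a multiple of \<open>d a\<close>.\<close>
  have "f \<otimes> (x \<oplus> d \<otimes> n \<otimes> p) \<oplus> (d \<otimes> a) \<otimes> (n \<otimes> q) \<oplus> b \<otimes> (a \<otimes> z)
    = f \<otimes> x \<oplus> d \<otimes> n \<otimes> (f \<otimes> p \<oplus> a \<otimes> q) \<oplus> a \<otimes> b \<otimes> z"
    using c ab f n pq(1,2) by algebra
  also have "\<dots> = f \<otimes> x \<oplus> d \<otimes> n \<oplus> a \<otimes> b \<otimes> z"
    using c ab f n unfolding pq(3) by simp
  also have "\<dots> = c \<otimes> x \<oplus> d \<otimes> y \<oplus> a \<otimes> b \<otimes> z"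
    using c ab k(1) unfolding n_def f_def by algebra
  finally have "f \<otimes> (x \<oplus> d \<otimes> n \<otimes> p) \<oplus>
      (d \<otimes> a) \<otimes> (n \<otimes> q) \<oplus> b \<otimes> (a \<otimes> z) = \<one>"
    unfolding e .
  then obtain m where m: "m \<in> carrier R" "comaximal R (f \<oplus> d \<otimes> a \<otimes> m) b"
    using c ab f n pq(1,2) by (elim stable_modD[OF sb, rotated 5]) auto
  have eq: "c \<oplus> d \<otimes> (k \<oplus> a \<otimes> m) = f \<oplus> d \<otimes> a \<otimes> m"
    "c \<oplus> d \<otimes> (k \<oplus> a \<otimes> m) = f \<oplus> a \<otimes> (d \<otimes> m)"
    unfolding f_def using c ab k(1) m(1) by algebra+
  have "comaximal R (c \<oplus> d \<otimes> (k \<oplus> a \<otimes> m)) a"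
    unfolding eq(2) using k m(1) c ab f by (intro comaximal_add) (auto simp: f_def)
  moreover have "comaximal R (c \<oplus> d \<otimes> (k \<oplus> a \<otimes> m)) b"
    using m(2) unfolding eq(1) .
  ultimately have "comaximal R (c \<oplus> d \<otimes> (k \<oplus> a \<otimes> m)) (a \<otimes> b)"
    using k(1) m(1) c ab by (intro comaximal_mult) auto
  then show "\<exists>k\<in>carrier R. comaximal R (c \<oplus> d \<otimes> k) (a \<otimes> b)"
    using k(1) m(1) ab by (intro bexI[of _ "k \<oplus> a \<otimes> m"]) auto
qed

text \<open>The given identity holds only modulo \<open>a\<close>, not modulo \<open>a b\<close>.
  Absorbing \<open>a z\<close> into the direction of the shift makes it exact, so the hypothesis
  applies; afterwards the resulting multiple of \<open>a\<close> is discarded, which does not affect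
  comaximality with \<open>a\<close>.\<close>

lemma stable_mod_factor:
  assumes ab: "a \<in> carrier R" "b \<in> carrier R" and s: "stable_mod R (a \<otimes> b)"
  shows "stable_mod R a"
  unfolding stable_mod_def
proof (intro ballI impI, elim bexE)
  fix c d x y z assume c: "c \<in> carrier R" "d \<in> carrier R" "x \<in> carrier R" "y \<in> carrier R" "z \<in> carrier R"
    and e: "c \<otimes> x \<oplus> d \<otimes> y \<oplus> a \<otimes> z = \<one>"
  have "c \<otimes> x \<oplus> (d \<otimes> y \<oplus> a \<otimes> z) \<otimes> \<one> \<oplus> (a \<otimes> b) \<otimes> \<zero> = c \<otimes> x \<oplus> d \<otimes> y \<oplus> a \<otimes> z"
    using c ab by (simp add: a_assoc)
  then have "c \<otimes> x \<oplus> (d \<otimes> y \<oplus> a \<otimes> z) \<otimes> \<one> \<oplus> (a \<otimes> b) \<otimes> \<zero> = \<one>"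
    unfolding e .
  then obtain k where k: "k \<in> carrier R" "comaximal R (c \<oplus> (d \<otimes> y \<oplus> a \<otimes> z) \<otimes> k) (a \<otimes> b)"
    using c ab by (elim stable_modD[OF s, rotated 5]) auto
  have "comaximal R (c \<oplus> (d \<otimes> y \<oplus> a \<otimes> z) \<otimes> k \<oplus> a \<otimes> (\<ominus> (z \<otimes> k))) a"
    using comaximal_factor[OF _ ab k(2)] k(1) c ab by (intro comaximal_add) auto
  moreover have "c \<oplus> (d \<otimes> y \<oplus> a \<otimes> z) \<otimes> k \<oplus> a \<otimes> (\<ominus> (z \<otimes> k)) = c \<oplus> d \<otimes> (y \<otimes> k)"
    using c ab k(1) by algebra
  ultimately show "\<exists>k\<in>carrier R. comaximal R (c \<oplus> d \<otimes> k) a"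
    using c k by (intro bexI[of _ "y \<otimes> k"]) auto
qed

text \<open>The Hermite condition without matrices: \<open>(a', b')\<close> is the first row of a
  matrix of determinant 1 with second row \<open>(-y, x)\<close>. With zero divisors present it asks
  for more than the existence of Bezout gcds, since the cofactors themselves must be comaximal. In
  this form it passes easily to localizations.\<close>

definition gcd_property :: bool where
  "gcd_property \<longleftrightarrow> (\<forall>a\<in>carrier R. \<forall>b\<in>carrier R.
    \<exists>g\<in>carrier R. \<exists>a'\<in>carrier R. \<exists>b'\<in>carrier R. \<exists>x\<in>carrier R. \<exists>y\<in>carrier R.
      a = g \<otimes> a' \<and> b = g \<otimes> b' \<and> a' \<otimes> x \<oplus> b' \<otimes> y = \<one>)"

lemma gcd_propertyE:
  assumes gcd_property "a \<in> carrier R" "b \<in> carrier R"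
  obtains g a' b' x y where "g \<in> carrier R" "a' \<in> carrier R" "b' \<in> carrier R" "x \<in> carrier R"
    "y \<in> carrier R" "a = g \<otimes> a'" "b = g \<otimes> b'" "a' \<otimes> x \<oplus> b' \<otimes> y = \<one>"
  using assms(1)[unfolded gcd_property_def, rule_format, OF assms(2,3)] by blast

lemma comaximal_ofI:
  assumes "a \<in> carrier R" "b \<in> carrier R" "x \<in> carrier R" "y \<in> carrier R" "a \<otimes> x \<oplus> b \<otimes> y = \<one>"
  shows "comaximal R a b"
  using assms comaximal_iff by blast

lemma dividesI:
  "c \<in> carrier R \<Longrightarrow> b = a \<otimes> c \<Longrightarrow> a divides b"
  unfolding factor_def by blast

text \<open>Adequacy with respect to \<open>a\<close> splits \<open>c\<close> as \<open>r s\<close>,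
  and the two factors are handled separately. Comaximality of \<open>f\<close> with \<open>r\<close>
  is inherited from that of \<open>a\<close> with \<open>r\<close>. For \<open>s\<close>, the gcd
  \<open>g\<close> of \<open>f\<close> and \<open>s\<close> turns out to be comaximal with
  \<open>a\<close>, and adequacy leaves only units among such divisors of \<open>s\<close>.\<close>

lemma stable_mod_adequate:
  assumes H: gcd_property and c: "c \<in> carrier R" and ad: "adequate R c"
  shows "stable_mod R c"
  unfolding stable_mod_def
proof (intro ballI impI, elim bexE)
  fix a b x y z assume ab: "a \<in> carrier R" "b \<in> carrier R" and xyz: "x \<in> carrier R" "y \<in> carrier R" "z \<in> carrier R"
    and e: "a \<otimes> x \<oplus> b \<otimes> y \<oplus> c \<otimes> z = \<one>"
  obtain r s where rs: "r \<in> carrier R" "s \<in> carrier R" "c = r \<otimes> s" "comaximal R r a"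
    and ns: "\<And>s'. \<lbrakk>s' \<in> carrier R; s' divides s; s' \<notin> Units R\<rbrakk> \<Longrightarrow> \<not> comaximal R s' a"
    using ad[unfolded adequate_def, rule_format, OF ab(1)] by blast
  \<comment> \<open>The shift by the factor \<open>r\<close> works: a common divisor \<open>h\<close> of \<open>f\<close>, \<open>s\<close> and \<open>a\<close> divides
    \<open>b \<otimes> r\<close> and is comaximal with \<open>r\<close>, so it divides \<open>b\<close> and is a unit.\<close>
  define f where "f = a \<oplus> b \<otimes> r"
  have f: "f \<in> carrier R" using ab rs by (simp add: f_def)
  have "f = a \<oplus> r \<otimes> b" using ab rs by (simp add: f_def m_comm)
  then have fr: "comaximal R f r"
    using comaximal_add[of a r b] comaximal_sym[of r a] ab rs by simp
  obtain g f' s' u v where g: "g \<in> carrier R" "f' \<in> carrier R" "s' \<in> carrier R" "u \<in> carrier R"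
    "v \<in> carrier R" "f = g \<otimes> f'" "s = g \<otimes> s'" "f' \<otimes> u \<oplus> s' \<otimes> v = \<one>"
    using gcd_propertyE[OF H f rs(2)] .
  obtain h g' a' u' v' where h: "h \<in> carrier R" "g' \<in> carrier R" "a' \<in> carrier R" "u' \<in> carrier R"
    "v' \<in> carrier R" "g = h \<otimes> g'" "a = h \<otimes> a'" "g' \<otimes> u' \<oplus> a' \<otimes> v' = \<one>"
    using gcd_propertyE[OF H g(1) ab(1)] .
  obtain p q where pq: "p \<in> carrier R" "q \<in> carrier R" "r \<otimes> p \<oplus> a \<otimes> q = \<one>"
    using rs(4) ab rs by (auto simp: comaximal_iff)
  have br: "b \<otimes> r = h \<otimes> (g' \<otimes> f' \<ominus> a')"
  proof -
    have "b \<otimes> r = f \<ominus> a" unfolding f_def using ab rs by algebra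
    also have "\<dots> = h \<otimes> g' \<otimes> f' \<ominus> h \<otimes> a'" using g(6) h(6,7) by simp
    also have "\<dots> = h \<otimes> (g' \<otimes> f' \<ominus> a')" using g(2) h(1-3) by algebra
    finally show ?thesis .
  qed
  have b: "b = h \<otimes> ((g' \<otimes> f' \<ominus> a') \<otimes> p \<oplus> a' \<otimes> q \<otimes> b)"
  proof -
    have "b = b \<otimes> (r \<otimes> p \<oplus> a \<otimes> q)" using pq ab by simp
    also have "\<dots> = (b \<otimes> r) \<otimes> p \<oplus> b \<otimes> a \<otimes> q" using pq(1,2) ab rs(1) by algebra
    also have "\<dots> = h \<otimes> (g' \<otimes> f' \<ominus> a') \<otimes> p \<oplus> b \<otimes> (h \<otimes> a') \<otimes> q" unfolding br using h(7) by simp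
    also have "\<dots> = h \<otimes> ((g' \<otimes> f' \<ominus> a') \<otimes> p \<oplus> a' \<otimes> q \<otimes> b)"
      using pq(1,2) ab(2) h(1-3) g(2) by algebra
    finally show ?thesis .
  qed
  define w where "w = (g' \<otimes> f' \<ominus> a') \<otimes> p \<oplus> a' \<otimes> q \<otimes> b"
  have w: "w \<in> carrier R" unfolding w_def using h g pq ab by simp
  \<comment> \<open>\<open>h\<close> divides \<open>a\<close>, \<open>b\<close> and, through
    \<open>g\<close> and \<open>s\<close>, also \<open>c\<close>. It can be pulled out of the whole
    identity \<open>e\<close>, and the bracket that remains is its inverse.\<close>
  have "h \<otimes> (a' \<otimes> x \<oplus> w \<otimes> y \<oplus> r \<otimes> g' \<otimes> s' \<otimes> z)
      = h \<otimes> a' \<otimes> x \<oplus> (h \<otimes> w) \<otimes> y \<oplus> r \<otimes> (h \<otimes> g' \<otimes> s') \<otimes> z"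
    using h(1-3) w xyz rs(1) g(3) by algebra
  also have "\<dots> = \<one>"
    unfolding h(6,7)[symmetric] b[folded w_def, symmetric] g(7)[symmetric] rs(3)[symmetric] by (rule e)
  finally have hu: "h \<otimes> (a' \<otimes> x \<oplus> w \<otimes> y \<oplus> r \<otimes> g' \<otimes> s' \<otimes> z) = \<one>" .
  have "comaximal R g a"
  proof -
    let ?i = "a' \<otimes> x \<oplus> w \<otimes> y \<oplus> r \<otimes> g' \<otimes> s' \<otimes> z"
    have i: "?i \<in> carrier R" using h g w xyz rs by simp
    have "g \<otimes> (u' \<otimes> ?i) \<oplus> a \<otimes> (v' \<otimes> ?i) = h \<otimes> ?i \<otimes> (g' \<otimes> u' \<oplus> a' \<otimes> v')"
      unfolding h(6,7) using i h(1-5) by algebra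
    then show ?thesis unfolding hu h(8) using i h g ab
      by (intro comaximal_ofI[of g a "u' \<otimes> ?i" "v' \<otimes> ?i"]) auto
  qed
  then have "g \<in> Units R"
    using ns[OF g(1) dividesI[OF g(3,7)]] by blast
  have "comaximal R f s"
  proof -
    obtain j where j: "j \<in> carrier R" "g \<otimes> j = \<one>"
      using \<open>g \<in> Units R\<close> Units_r_inv Units_inv_closed by blast
    have "f \<otimes> (u \<otimes> j) \<oplus> s \<otimes> (v \<otimes> j) = (f' \<otimes> u \<oplus> s' \<otimes> v) \<otimes> (g \<otimes> j)"
      unfolding g(6,7) using g(1-5) j(1) by algebra
    then show ?thesis unfolding g(8) j(2)
      using g j f rs by (intro comaximal_ofI[of f s "u \<otimes> j" "v \<otimes> j"]) auto
  qed
  then have "comaximal R f c"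
    unfolding rs(3) using comaximal_mult[OF f rs(1,2) fr] by blast
  then show "\<exists>k\<in>carrier R. comaximal R (a \<oplus> b \<otimes> k) c"
    using rs(1) unfolding f_def by blast
qed

end

section \<open>Localizations\<close>

context mult_closed
begin

lemma fraction_in_carrier:
  "a \<in> carrier R \<Longrightarrow> s \<in> S \<Longrightarrow> fraction R S a s \<in> carrier (localization R S)"
  unfolding localization_def fraction_def by (auto intro: quotientI)

lemma localization_carrierE:
  assumes "x \<in> carrier (localization R S)"
  obtains a s where "a \<in> carrier R" "s \<in> S" "x = fraction R S a s"
  using assms unfolding localization_def fraction_def by (auto elim!: quotientE)

lemma localization_one: "\<one>\<^bsub>localization R S\<^esub> = fraction R S \<one> \<one>"
  and localization_zero: "\<zero>\<^bsub>localization R S\<^esub> = fraction R S \<zero> \<one>"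
  by (simp_all add: localization_def)

lemma fraction_eqI:
  assumes "a \<in> carrier R" "s \<in> S" "b \<in> carrier R" "t \<in> S" "a \<otimes> t = b \<otimes> s"
  shows "fraction R S a s = fraction R S b t"
  using assms one_S by (subst fraction_eq_iff) auto

lemma fraction_self: "s \<in> S \<Longrightarrow> fraction R S s s = fraction R S \<one> \<one>"
  using S_closed one_S by (intro fraction_eqI) auto

lemma cring_localization: "cring (localization R S)"
proof (rule cringI)
  show "abelian_group (localization R S)"
  proof (rule abelian_groupI)
    fix x y z
    assume "x \<in> carrier (localization R S)" "y \<in> carrier (localization R S)"
      "z \<in> carrier (localization R S)"
    then show "x \<oplus>\<^bsub>localization R S\<^esub> y \<oplus>\<^bsub>localization R S\<^esub> z =
        x \<oplus>\<^bsub>localization R S\<^esub> (y \<oplus>\<^bsub>localization R S\<^esub> z)"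
      by (elim localization_carrierE)
        (auto simp: localization_add_fraction S_closed mult_S l_distr r_distr m_ac a_ac
          intro!: fraction_eqI)
  next
    fix x y
    assume "x \<in> carrier (localization R S)" "y \<in> carrier (localization R S)"
    then show "x \<oplus>\<^bsub>localization R S\<^esub> y \<in> carrier (localization R S)"
      and "x \<oplus>\<^bsub>localization R S\<^esub> y = y \<oplus>\<^bsub>localization R S\<^esub> x"
      by (auto elim!: localization_carrierE simp: localization_add_fraction S_closed mult_S m_comm a_comm
          intro!: fraction_in_carrier)
  next
    show "\<zero>\<^bsub>localization R S\<^esub> \<in> carrier (localization R S)"
      unfolding localization_zero by (simp add: fraction_in_carrier one_S)
  next
    fix x
    assume x: "x \<in> carrier (localization R S)"
    then show "\<zero>\<^bsub>localization R S\<^esub> \<oplus>\<^bsub>localization R S\<^esub> x = x"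
      by (auto elim!: localization_carrierE
          simp: localization_zero localization_add_fraction S_closed mult_S one_S)
    from x show "\<exists>y\<in>carrier (localization R S). y \<oplus>\<^bsub>localization R S\<^esub> x = \<zero>\<^bsub>localization R S\<^esub>"
    proof (elim localization_carrierE)
      fix a s assume "a \<in> carrier R" "s \<in> S" "x = fraction R S a s"
      moreover from this have "fraction R S \<zero> (s \<otimes> s) = fraction R S \<zero> \<one>"
        by (intro fraction_eqI) (auto simp: S_closed mult_S one_S)
      ultimately show ?thesis
        by (intro bexI[of _ "fraction R S (\<ominus> a) s"])
          (auto simp: localization_zero localization_add_fraction S_closed l_minus l_neg
            intro!: fraction_in_carrier)
    qed
  qed
  show "comm_monoid (localization R S)"
  proof (rule comm_monoidI)
    fix x y z
    assume xyz: "x \<in> carrier (localization R S)" "y \<in> carrier (localization R S)"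
      "z \<in> carrier (localization R S)"
    then show "x \<otimes>\<^bsub>localization R S\<^esub> y \<otimes>\<^bsub>localization R S\<^esub> z =
        x \<otimes>\<^bsub>localization R S\<^esub> (y \<otimes>\<^bsub>localization R S\<^esub> z)"
      by (elim localization_carrierE)
        (auto simp: localization_mult_fraction S_closed mult_S m_ac)
    show "\<one>\<^bsub>localization R S\<^esub> \<otimes>\<^bsub>localization R S\<^esub> x = x"
      using xyz(1) by (elim localization_carrierE)
        (auto simp: localization_one localization_mult_fraction S_closed one_S)
  next
    fix x y
    assume "x \<in> carrier (localization R S)" "y \<in> carrier (localization R S)"
    then show "x \<otimes>\<^bsub>localization R S\<^esub> y \<in> carrier (localization R S)"
      and "x \<otimes>\<^bsub>localization R S\<^esub> y = y \<otimes>\<^bsub>localization R S\<^esub> x"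
      by (auto elim!: localization_carrierE simp: localization_mult_fraction S_closed mult_S m_comm
          intro!: fraction_in_carrier)
  next
    show "\<one>\<^bsub>localization R S\<^esub> \<in> carrier (localization R S)"
      unfolding localization_one by (simp add: fraction_in_carrier one_S)
  qed
  fix x y z
  assume "x \<in> carrier (localization R S)" "y \<in> carrier (localization R S)"
    "z \<in> carrier (localization R S)"
  then show "(x \<oplus>\<^bsub>localization R S\<^esub> y) \<otimes>\<^bsub>localization R S\<^esub> z =
      x \<otimes>\<^bsub>localization R S\<^esub> z \<oplus>\<^bsub>localization R S\<^esub> y \<otimes>\<^bsub>localization R S\<^esub> z"
  proof (elim localization_carrierE)
    fix a s b t c v
    assume h: "a \<in> carrier R" "s \<in> S" "b \<in> carrier R" "t \<in> S" "c \<in> carrier R" "v \<in> S"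
      and "x = fraction R S a s" "y = fraction R S b t" "z = fraction R S c v"
    moreover have "fraction R S ((a \<otimes> t \<oplus> b \<otimes> s) \<otimes> c) (s \<otimes> t \<otimes> v) =
        fraction R S (a \<otimes> c \<otimes> (t \<otimes> v) \<oplus> b \<otimes> c \<otimes> (s \<otimes> v)) (s \<otimes> v \<otimes> (t \<otimes> v))"
      using h by (intro fraction_eqI) (auto simp: S_closed mult_S, simp add: S_closed l_distr r_distr m_ac)
    ultimately show ?thesis
      by (simp add: localization_add_fraction localization_mult_fraction S_closed mult_S)
  qed
qed

text \<open>If \<open>c/t\<close> inverts \<open>a/s\<close>, then \<open>a (u c) = u s t\<close>
  lies in \<open>S\<close> for some \<open>u\<close> in \<open>S\<close>; conversely
  \<open>(b s)/(a b)\<close> inverts \<open>a/s\<close>. The units are thus governed by the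
  saturation of \<open>S\<close>.\<close>

lemma fraction_Units_iff:
  assumes "a \<in> carrier R" "s \<in> S"
  shows "fraction R S a s \<in> Units (localization R S) \<longleftrightarrow> (\<exists>b\<in>carrier R. a \<otimes> b \<in> S)"
proof -
  interpret L: cring "localization R S" by (rule cring_localization)
  note a = assms(1) S_closed[OF assms(2)]
  show ?thesis
  proof
    assume "fraction R S a s \<in> Units (localization R S)"
    then obtain x where x: "x \<in> carrier (localization R S)"
        "fraction R S a s \<otimes>\<^bsub>localization R S\<^esub> x = \<one>\<^bsub>localization R S\<^esub>"
      by (metis L.Units_inv_closed L.Units_r_inv)
    obtain c t where ct: "c \<in> carrier R" "t \<in> S" "x = fraction R S c t"
      using x(1) by (elim localization_carrierE)
    obtain u where u: "u \<in> S" "u \<otimes> (a \<otimes> c \<otimes> \<one>) = u \<otimes> (\<one> \<otimes> (s \<otimes> t))"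
      using x(2) assms ct fraction_eq_iff[of "a \<otimes> c" "s \<otimes> t" \<one> \<one>]
      by (auto simp: localization_mult_fraction localization_one mult_S one_S)
    have "a \<otimes> (u \<otimes> c) = u \<otimes> (s \<otimes> t)"
      using u a ct S_closed by (simp add: m_lcomm)
    then show "\<exists>b\<in>carrier R. a \<otimes> b \<in> S"
      using u(1) assms ct(1,2) by (intro bexI[of _ "u \<otimes> c"]) (auto simp: mult_S S_closed)
  next
    assume "\<exists>b\<in>carrier R. a \<otimes> b \<in> S"
    then obtain b where b: "b \<in> carrier R" "a \<otimes> b \<in> S" by blast
    have "fraction R S a s \<otimes>\<^bsub>localization R S\<^esub> fraction R S (b \<otimes> s) (a \<otimes> b) = \<one>\<^bsub>localization R S\<^esub>"
      unfolding localization_one using assms b a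
      by (subst localization_mult_fraction, simp_all, intro fraction_eqI)
        (auto simp: mult_S one_S, simp add: m_ac)
    then show "fraction R S a s \<in> Units (localization R S)"
      using assms b a by (metis L.Units_one_closed L.prod_unit_l L.prod_unit_r L.unit_factor fraction_in_carrier m_closed)
  qed
qed

text \<open>Denominators are units, so only numerators matter; clearing them in a Bezout identity
  leaves an element of \<open>S\<close> in place of 1.\<close>

lemma comaximal_fraction_iff:
  assumes "a \<in> carrier R" "s \<in> S" "b \<in> carrier R" "t \<in> S"
  shows "comaximal (localization R S) (fraction R S a s) (fraction R S b t) \<longleftrightarrow>
    (\<exists>x\<in>carrier R. \<exists>y\<in>carrier R. a \<otimes> x \<oplus> b \<otimes> y \<in> S)"
proof -
  interpret L: cring "localization R S" by (rule cring_localization)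
  note ca = assms(1,3) assms(2,4)[THEN S_closed]
  show ?thesis
  proof
    assume "comaximal (localization R S) (fraction R S a s) (fraction R S b t)"
    then obtain v w where vw: "v \<in> carrier (localization R S)" "w \<in> carrier (localization R S)"
        "fraction R S a s \<otimes>\<^bsub>localization R S\<^esub> v \<oplus>\<^bsub>localization R S\<^esub>
         fraction R S b t \<otimes>\<^bsub>localization R S\<^esub> w = \<one>\<^bsub>localization R S\<^esub>"
      using assms by (auto simp: L.comaximal_iff fraction_in_carrier)
    obtain x p where x: "x \<in> carrier R" "p \<in> S" "v = fraction R S x p"
      using vw(1) by (elim localization_carrierE)
    obtain y q where y: "y \<in> carrier R" "q \<in> S" "w = fraction R S y q"
      using vw(2) by (elim localization_carrierE)
    note cx = x(1) y(1) x(2)[THEN S_closed] y(2)[THEN S_closed]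
    let ?n = "a \<otimes> x \<otimes> (t \<otimes> q) \<oplus> b \<otimes> y \<otimes> (s \<otimes> p)"
    let ?d = "s \<otimes> p \<otimes> (t \<otimes> q)"
    have "fraction R S ?n ?d = fraction R S \<one> \<one>"
      using vw(3) assms x y
      by (simp add: localization_mult_fraction localization_add_fraction localization_one mult_S)
    then obtain u where u: "u \<in> S" "u \<otimes> (?n \<otimes> \<one>) = u \<otimes> (\<one> \<otimes> ?d)"
      using fraction_eq_iff[of ?n ?d \<one> \<one>] assms x(1,2) y(1,2) ca cx
      by (auto simp: mult_S one_S)
    \<comment> \<open>The multiplier \<open>u\<close> and the denominators are moved into the
      coefficients of \<open>a\<close> and \<open>b\<close>.\<close>
    have "a \<otimes> (u \<otimes> x \<otimes> t \<otimes> q) \<oplus> b \<otimes> (u \<otimes> y \<otimes> s \<otimes> p) = u \<otimes> (?n \<otimes> \<one>)"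
      using S_closed[OF u(1)] ca cx by algebra
    also have "\<dots> \<in> S"
      unfolding u(2) using u(1) assms x(2) y(2) ca cx by (auto simp: mult_S)
    finally show "\<exists>x\<in>carrier R. \<exists>y\<in>carrier R. a \<otimes> x \<oplus> b \<otimes> y \<in> S"
      using S_closed[OF u(1)] ca cx
      by (intro bexI[of _ "u \<otimes> x \<otimes> t \<otimes> q"] bexI[of _ "u \<otimes> y \<otimes> s \<otimes> p"]) auto
  next
    assume "\<exists>x\<in>carrier R. \<exists>y\<in>carrier R. a \<otimes> x \<oplus> b \<otimes> y \<in> S"
    then obtain x y where xy: "x \<in> carrier R" "y \<in> carrier R" "a \<otimes> x \<oplus> b \<otimes> y \<in> S" by blast
    define v where "v = a \<otimes> x \<oplus> b \<otimes> y"
    have v: "v \<in> S" using xy by (simp add: v_def)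
    \<comment> \<open>The coefficients \<open>(x s)/v\<close> and \<open>(y t)/v\<close> cancel the
      denominators \<open>s\<close> and \<open>t\<close>, so the sum becomes
      \<open>(a x + b y)/v\<close>, which is 1.\<close>
    have "a \<otimes> (x \<otimes> s) \<otimes> (t \<otimes> v) \<oplus> b \<otimes> (y \<otimes> t) \<otimes> (s \<otimes> v) = (s \<otimes> t \<otimes> v) \<otimes> (a \<otimes> x \<oplus> b \<otimes> y)"
      using ca xy(1,2) S_closed[OF v] by algebra
    also have "\<dots> = s \<otimes> v \<otimes> (t \<otimes> v)"
      unfolding v_def[symmetric] using ca S_closed[OF v] by algebra
    finally have "fraction R S a s \<otimes>\<^bsub>localization R S\<^esub> fraction R S (x \<otimes> s) v \<oplus>\<^bsub>localization R S\<^esub>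
        fraction R S b t \<otimes>\<^bsub>localization R S\<^esub> fraction R S (y \<otimes> t) v = \<one>\<^bsub>localization R S\<^esub>"
      using assms ca xy(1,2) v S_closed[OF v]
      by (simp add: localization_mult_fraction localization_add_fraction localization_one
          mult_S fraction_self)
    then show "comaximal (localization R S) (fraction R S a s) (fraction R S b t)"
      using assms ca xy(1,2) v by (intro L.comaximal_ofI) (auto intro!: fraction_in_carrier)
  qed
qed

text \<open>Over the common denominator \<open>s t\<close> the numerators are \<open>a t\<close> and
  \<open>b s\<close>. Their gcd in \<open>R\<close> carries the denominator, so the cofactors keep
  denominator 1 and inherit their Bezout identity from \<open>R\<close>.\<close>

lemma gcd_property_localization:
  assumes gcd_property
  shows "cring.gcd_property (localization R S)"
proof -
  interpret L: cring "localization R S" by (rule cring_localization)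
  show ?thesis
    unfolding L.gcd_property_def
  proof (intro ballI)
    fix v w assume "v \<in> carrier (localization R S)" "w \<in> carrier (localization R S)"
    then obtain a s b t where as: "a \<in> carrier R" "s \<in> S" "v = fraction R S a s"
      and bt: "b \<in> carrier R" "t \<in> S" "w = fraction R S b t"
      by (elim localization_carrierE)
    note c = as(1) bt(1) as(2)[THEN S_closed] bt(2)[THEN S_closed]
    obtain g a' b' x y where g: "g \<in> carrier R" "a' \<in> carrier R" "b' \<in> carrier R" "x \<in> carrier R"
      "y \<in> carrier R" "a \<otimes> t = g \<otimes> a'" "b \<otimes> s = g \<otimes> b'" "a' \<otimes> x \<oplus> b' \<otimes> y = \<one>"
      using gcd_propertyE[OF assms m_closed[OF c(1,4)] m_closed[OF c(2,3)]] .
    have "v = fraction R S g (s \<otimes> t) \<otimes>\<^bsub>localization R S\<^esub> fraction R S a' \<one>"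
    proof -
      have "a \<otimes> (s \<otimes> t) = s \<otimes> (g \<otimes> a')" unfolding g(6)[symmetric] using c by (simp add: m_ac)
      then have "fraction R S a s = fraction R S (g \<otimes> a') (s \<otimes> t)"
        using as bt g(1-3) c by (intro fraction_eqI) (auto simp: mult_S m_comm)
      then show ?thesis
        using as bt g(1-3) c by (simp add: localization_mult_fraction mult_S one_S)
    qed
    moreover have "w = fraction R S g (s \<otimes> t) \<otimes>\<^bsub>localization R S\<^esub> fraction R S b' \<one>"
    proof -
      have "b \<otimes> (s \<otimes> t) = t \<otimes> (g \<otimes> b')" unfolding g(7)[symmetric] using c by (simp add: m_ac)
      then have "fraction R S b t = fraction R S (g \<otimes> b') (s \<otimes> t)"
        using as bt g(1-3) c by (intro fraction_eqI) (auto simp: mult_S m_comm)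
      then show ?thesis
        using as bt g(1-3) c by (simp add: localization_mult_fraction mult_S one_S)
    qed
    moreover have "fraction R S a' \<one> \<otimes>\<^bsub>localization R S\<^esub> fraction R S x \<one> \<oplus>\<^bsub>localization R S\<^esub>
        fraction R S b' \<one> \<otimes>\<^bsub>localization R S\<^esub> fraction R S y \<one> = \<one>\<^bsub>localization R S\<^esub>"
      using g by (simp add: localization_mult_fraction localization_add_fraction localization_one one_S)
    moreover have "fraction R S g (s \<otimes> t) \<in> carrier (localization R S)"
        "fraction R S a' \<one> \<in> carrier (localization R S)"
        "fraction R S b' \<one> \<in> carrier (localization R S)"
        "fraction R S x \<one> \<in> carrier (localization R S)"
        "fraction R S y \<one> \<in> carrier (localization R S)"
      using g(1-5) as(2) bt(2) by (auto intro!: fraction_in_carrier simp: one_S mult_S)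
    ultimately show "\<exists>g\<in>carrier (localization R S). \<exists>a'\<in>carrier (localization R S).
        \<exists>b'\<in>carrier (localization R S). \<exists>x\<in>carrier (localization R S). \<exists>y\<in>carrier (localization R S).
        v = g \<otimes>\<^bsub>localization R S\<^esub> a' \<and> w = g \<otimes>\<^bsub>localization R S\<^esub> b' \<and>
        a' \<otimes>\<^bsub>localization R S\<^esub> x \<oplus>\<^bsub>localization R S\<^esub> b' \<otimes>\<^bsub>localization R S\<^esub> y = \<one>\<^bsub>localization R S\<^esub>"
      by blast
  qed
qed

end

section \<open>The ring \<open>R_a\<close> and stable range 1 modulo \<open>a\<close>\<close>

context cring
begin

lemma mult_closed_comaximal_set:
  assumes "a \<in> carrier R"
  shows "mult_closed R (comaximal_set R a)"
proof unfold_locales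
  show "comaximal_set R a \<subseteq> carrier R" by (auto simp: comaximal_set_def)
  show "\<one> \<in> comaximal_set R a"
    unfolding comaximal_set_def using assms comaximal_ofI[of a \<one> \<zero> \<one>] by simp
  show "s \<otimes> t \<in> comaximal_set R a" if "s \<in> comaximal_set R a" "t \<in> comaximal_set R a" for s t
    using that assms by (auto simp: comaximal_set_def intro!: comaximal_mult)
qed

text \<open>Elements of \<open>S_a\<close> are those invertible modulo \<open>a\<close>, and a
  fraction is a unit of \<open>R_a\<close> exactly if its numerator is one of them. Hence being a
  unit of \<open>R_a\<close> can be tested modulo \<open>a\<close>, where each denominator has an
  inverse represented in \<open>R\<close>.\<close>

lemma stable_range_1_localization_iff:
  assumes a: "a \<in> carrier R"
  shows "stable_range_1 (localization R (comaximal_set R a)) \<longleftrightarrow> stable_mod R a"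
proof -
  let ?S = "comaximal_set R a"
  let ?L = "localization R ?S"
  interpret mult_closed R ?S by (rule mult_closed_comaximal_set[OF a])
  \<comment> \<open>\<open>S_a\<close> is saturated, so the numerator of a unit lies in
    \<open>S_a\<close> itself and not merely below one of its elements.\<close>
  have Sfac: "f \<in> ?S" if "f \<in> carrier R" "g \<in> carrier R" "f \<otimes> g \<in> ?S" for f g
    using that a comaximal_factor[of a f g] by (auto simp: comaximal_set_def)
  have S_iff: "f \<in> ?S \<longleftrightarrow> f \<in> carrier R \<and> comaximal R f a" for f
    using a comaximal_sym[of a f] comaximal_sym[of f a] by (auto simp: comaximal_set_def)
  show ?thesis
  proof
    assume sr: "stable_range_1 ?L"
    show "stable_mod R a"
      unfolding stable_mod_def
    proof (intro ballI impI, elim bexE)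
      fix c d x y z assume c: "c \<in> carrier R" "d \<in> carrier R" "x \<in> carrier R" "y \<in> carrier R" "z \<in> carrier R"
        and e: "c \<otimes> x \<oplus> d \<otimes> y \<oplus> a \<otimes> z = \<one>"
      have "c \<otimes> x \<oplus> d \<otimes> y \<in> ?S"
        unfolding S_iff using c a e by (auto intro!: comaximal_ofI[of _ _ \<one> z])
      then have "comaximal ?L (fraction R ?S c \<one>) (fraction R ?S d \<one>)"
        using c by (subst comaximal_fraction_iff) (auto simp: one_S)
      then obtain w where w: "w \<in> carrier ?L"
          "fraction R ?S c \<one> \<oplus>\<^bsub>?L\<^esub> fraction R ?S d \<one> \<otimes>\<^bsub>?L\<^esub> w \<in> Units ?L"
        using sr c unfolding stable_range_1_def by (metis fraction_in_carrier one_S)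
      obtain k s where ks: "k \<in> carrier R" "s \<in> ?S" "w = fraction R ?S k s"
        using w(1) by (elim localization_carrierE)
      have cs: "s \<in> carrier R" using ks(2) S_closed by blast
      have "fraction R ?S (c \<otimes> s \<oplus> d \<otimes> k) s \<in> Units ?L"
        using w(2) c ks cs
        by (simp add: localization_mult_fraction localization_add_fraction one_S)
      then have "c \<otimes> s \<oplus> d \<otimes> k \<in> ?S"
        using c ks cs Sfac[of "c \<otimes> s \<oplus> d \<otimes> k"] by (subst (asm) fraction_Units_iff) auto
      \<comment> \<open>\<open>s'\<close> inverts \<open>s\<close> modulo \<open>a\<close>.
        Multiplying by \<open>s'\<close> and adding \<open>a (c q)\<close> turns
        \<open>c s + d k\<close> into \<open>c + d (k s')\<close> and preserves invertibility modulo
        \<open>a\<close>.\<close>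
      obtain s' q where s': "s' \<in> carrier R" "q \<in> carrier R" "s \<otimes> s' \<oplus> a \<otimes> q = \<one>"
        using ks(2) a unfolding S_iff by (auto simp: comaximal_iff)
      have "s' \<in> ?S"
        unfolding S_iff using s' a cs by (auto simp: m_comm intro!: comaximal_ofI[of _ _ s q])
      have "(c \<otimes> s \<oplus> d \<otimes> k) \<otimes> s' \<in> ?S"
        by (rule mult_S) fact+
      then have "comaximal R ((c \<otimes> s \<oplus> d \<otimes> k) \<otimes> s' \<oplus> a \<otimes> (c \<otimes> q)) a"
        unfolding S_iff using a c s' by (intro comaximal_add) auto
      moreover have "(c \<otimes> s \<oplus> d \<otimes> k) \<otimes> s' \<oplus> a \<otimes> (c \<otimes> q) = c \<otimes> (s \<otimes> s' \<oplus> a \<otimes> q) \<oplus> d \<otimes> (k \<otimes> s')"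
        using a c s'(1,2) ks(1) cs by algebra
      ultimately have "comaximal R (c \<oplus> d \<otimes> (k \<otimes> s')) a"
        unfolding s'(3) using c by simp
      then show "\<exists>k\<in>carrier R. comaximal R (c \<oplus> d \<otimes> k) a"
        using ks(1) s'(1) by blast
    qed
  next
    assume sm: "stable_mod R a"
    show "stable_range_1 ?L"
      unfolding stable_range_1_def
    proof (intro ballI impI)
      fix v w assume "v \<in> carrier ?L" "w \<in> carrier ?L" and cm: "comaximal ?L v w"
      then obtain c s d t where cs: "c \<in> carrier R" "s \<in> ?S" "v = fraction R ?S c s"
        and dt: "d \<in> carrier R" "t \<in> ?S" "w = fraction R ?S d t"
        by (elim localization_carrierE)
      have st: "s \<in> carrier R" "t \<in> carrier R" using cs dt S_closed by auto
      obtain x y where xy: "x \<in> carrier R" "y \<in> carrier R" "c \<otimes> x \<oplus> d \<otimes> y \<in> ?S"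
        using cm cs dt by (auto simp: comaximal_fraction_iff)
      \<comment> \<open>Over the denominator \<open>s t\<close> the two fractions have numerators
        \<open>c t\<close> and \<open>d s\<close>. Scaling by \<open>s t\<close> expresses the
        Bezout identity in these numerators; the shift obtained from them then has denominator
        1.\<close>
      let ?e = "(c \<otimes> x \<oplus> d \<otimes> y) \<otimes> (s \<otimes> t)"
      have "?e \<in> ?S"
        using xy(3) cs(2) dt(2) by (simp add: mult_S)
      then obtain p q where pq: "p \<in> carrier R" "q \<in> carrier R" "?e \<otimes> p \<oplus> a \<otimes> q = \<one>"
        using a unfolding S_iff by (auto simp: comaximal_iff)
      have "(c \<otimes> t) \<otimes> (x \<otimes> s \<otimes> p) \<oplus> (d \<otimes> s) \<otimes> (y \<otimes> t \<otimes> p) \<oplus> a \<otimes> q = ?e \<otimes> p \<oplus> a \<otimes> q"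
        using cs(1) dt(1) xy(1,2) st pq(1,2) a by algebra
      then have "(c \<otimes> t) \<otimes> (x \<otimes> s \<otimes> p) \<oplus> (d \<otimes> s) \<otimes> (y \<otimes> t \<otimes> p) \<oplus> a \<otimes> q = \<one>"
        unfolding pq(3) .
      then obtain k where k: "k \<in> carrier R" "comaximal R (c \<otimes> t \<oplus> d \<otimes> s \<otimes> k) a"
        using cs(1) dt(1) xy(1,2) st pq(1,2) a by (elim stable_modD[OF sm, rotated 5]) auto
      have "v \<oplus>\<^bsub>?L\<^esub> w \<otimes>\<^bsub>?L\<^esub> fraction R ?S k \<one> = fraction R ?S (c \<otimes> t \<oplus> d \<otimes> k \<otimes> s) (s \<otimes> t)"
        using cs dt k(1) st by (simp add: localization_mult_fraction localization_add_fraction one_S)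
      moreover have "c \<otimes> t \<oplus> d \<otimes> k \<otimes> s = c \<otimes> t \<oplus> d \<otimes> s \<otimes> k"
        using cs(1) dt(1) st k(1) by (simp add: m_ac)
      moreover have "fraction R ?S (c \<otimes> t \<oplus> d \<otimes> s \<otimes> k) (s \<otimes> t) \<in> Units ?L"
      proof (subst fraction_Units_iff)
        show "s \<otimes> t \<in> ?S" using cs(2) dt(2) by (rule mult_S)
        show "\<exists>b\<in>carrier R. (c \<otimes> t \<oplus> d \<otimes> s \<otimes> k) \<otimes> b \<in> ?S"
          using cs(1) dt(1) k st by (intro bexI[of _ \<one>]) (simp_all add: S_iff)
      qed (use cs(1) dt(1) k(1) st in simp)
      ultimately show "\<exists>y\<in>carrier ?L. v \<oplus>\<^bsub>?L\<^esub> w \<otimes>\<^bsub>?L\<^esub> y \<in> Units ?L"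
        using k(1) by (intro bexI[of _ "fraction R ?S k \<one>"]) (auto intro!: fraction_in_carrier one_S)
    qed
  qed
qed

lemma loc_stable_range_1_set_eq: "loc_stable_range_1_set R = {a \<in> carrier R. stable_mod R a}"
  unfolding loc_stable_range_1_set_def by (auto simp: stable_range_1_localization_iff)

lemma mult_closed_loc_stable_range_1_set: "mult_closed R (loc_stable_range_1_set R)"
  unfolding loc_stable_range_1_set_eq
  by unfold_locales (auto simp: stable_mod_one stable_mod_mult)

end

section \<open>Values of 2 by 2 bilinear forms\<close>

text \<open>The matrix has rows \<open>(a, b)\<close> and \<open>(c, d)\<close>; it is evaluated at
  the row \<open>(p, p')\<close> and the column \<open>(q, q')\<close>. Neither vector is assumed
  unimodular, so a value of this kind survives the clearing of denominators.\<close>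

definition represents :: "('a, 'm) ring_scheme \<Rightarrow> 'a \<Rightarrow> 'a \<Rightarrow> 'a \<Rightarrow> 'a \<Rightarrow> 'a \<Rightarrow> bool" where
  "represents R a b c d t \<longleftrightarrow>
    (\<exists>p\<in>carrier R. \<exists>p'\<in>carrier R. \<exists>q\<in>carrier R. \<exists>q'\<in>carrier R.
      p \<otimes>\<^bsub>R\<^esub> (a \<otimes>\<^bsub>R\<^esub> q \<oplus>\<^bsub>R\<^esub> b \<otimes>\<^bsub>R\<^esub> q') \<oplus>\<^bsub>R\<^esub> p' \<otimes>\<^bsub>R\<^esub> (c \<otimes>\<^bsub>R\<^esub> q \<oplus>\<^bsub>R\<^esub> d \<otimes>\<^bsub>R\<^esub> q') = t)"

definition unimodular :: "('a, 'm) ring_scheme \<Rightarrow> 'a \<Rightarrow> 'a \<Rightarrow> 'a \<Rightarrow> 'a \<Rightarrow> bool" where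
  "unimodular R a b c d \<longleftrightarrow>
    (\<exists>x\<in>carrier R. \<exists>y\<in>carrier R. \<exists>z\<in>carrier R. \<exists>w\<in>carrier R.
      a \<otimes>\<^bsub>R\<^esub> x \<oplus>\<^bsub>R\<^esub> b \<otimes>\<^bsub>R\<^esub> y \<oplus>\<^bsub>R\<^esub> c \<otimes>\<^bsub>R\<^esub> z \<oplus>\<^bsub>R\<^esub> d \<otimes>\<^bsub>R\<^esub> w = \<one>\<^bsub>R\<^esub>)"

context cring
begin

lemma representsI:
  assumes "p \<in> carrier R" "p' \<in> carrier R" "q \<in> carrier R" "q' \<in> carrier R"
    "p \<otimes> (a \<otimes> q \<oplus> b \<otimes> q') \<oplus> p' \<otimes> (c \<otimes> q \<oplus> d \<otimes> q') = t"
  shows "represents R a b c d t"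
  using assms unfolding represents_def by blast

lemma unimodularI:
  assumes "x \<in> carrier R" "y \<in> carrier R" "z \<in> carrier R" "w \<in> carrier R"
    "a \<otimes> x \<oplus> b \<otimes> y \<oplus> c \<otimes> z \<oplus> d \<otimes> w = \<one>"
  shows "unimodular R a b c d"
  using assms unfolding unimodular_def by blast

lemma represents_transpose:
  assumes "a \<in> carrier R" "b \<in> carrier R" "c \<in> carrier R" "d \<in> carrier R" "represents R a b c d t"
  shows "represents R a c b d t"
proof -
  obtain p p' q q' where p: "p \<in> carrier R" "p' \<in> carrier R" "q \<in> carrier R" "q' \<in> carrier R"
    "p \<otimes> (a \<otimes> q \<oplus> b \<otimes> q') \<oplus> p' \<otimes> (c \<otimes> q \<oplus> d \<otimes> q') = t"
    using assms unfolding represents_def by blast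
  have "q \<otimes> (a \<otimes> p \<oplus> c \<otimes> p') \<oplus> q' \<otimes> (b \<otimes> p \<oplus> d \<otimes> p') =
      p \<otimes> (a \<otimes> q \<oplus> b \<otimes> q') \<oplus> p' \<otimes> (c \<otimes> q \<oplus> d \<otimes> q')"
    using assms(1-4) p(1-4) by algebra
  then show ?thesis
    using p by (intro representsI[of q q' p p']) auto
qed

lemma unimodular_transpose:
  assumes "a \<in> carrier R" "b \<in> carrier R" "c \<in> carrier R" "d \<in> carrier R" "unimodular R a b c d"
  shows "unimodular R a c b d"
proof -
  obtain x y z w where x: "x \<in> carrier R" "y \<in> carrier R" "z \<in> carrier R" "w \<in> carrier R"
    "a \<otimes> x \<oplus> b \<otimes> y \<oplus> c \<otimes> z \<oplus> d \<otimes> w = \<one>"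
    using assms unfolding unimodular_def by blast
  have "a \<otimes> x \<oplus> c \<otimes> z \<oplus> b \<otimes> y \<oplus> d \<otimes> w = a \<otimes> x \<oplus> b \<otimes> y \<oplus> c \<otimes> z \<oplus> d \<otimes> w"
    using assms(1-4) x(1-4) by algebra
  then show ?thesis
    using x by (intro unimodularI[of x z y w]) auto
qed

text \<open>With \<open>M\<close> the matrix of rows \<open>(k, l)\<close> and
  \<open>(m, n)\<close>, evaluating \<open>M A\<close> at a row is evaluating \<open>A\<close> at
  that row times \<open>M\<close>.\<close>

lemma represents_row_ops:
  assumes "a \<in> carrier R" "b \<in> carrier R" "c \<in> carrier R" "d \<in> carrier R"
    and k: "k \<in> carrier R" "l \<in> carrier R" "m \<in> carrier R" "n \<in> carrier R"
    and "represents R (k \<otimes> a \<oplus> l \<otimes> c) (k \<otimes> b \<oplus> l \<otimes> d) (m \<otimes> a \<oplus> n \<otimes> c) (m \<otimes> b \<oplus> n \<otimes> d) t"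
  shows "represents R a b c d t"
proof -
  obtain p p' q q' where p: "p \<in> carrier R" "p' \<in> carrier R" "q \<in> carrier R" "q' \<in> carrier R"
    and e: "p \<otimes> ((k \<otimes> a \<oplus> l \<otimes> c) \<otimes> q \<oplus> (k \<otimes> b \<oplus> l \<otimes> d) \<otimes> q') \<oplus>
      p' \<otimes> ((m \<otimes> a \<oplus> n \<otimes> c) \<otimes> q \<oplus> (m \<otimes> b \<oplus> n \<otimes> d) \<otimes> q') = t"
    using assms(9) unfolding represents_def by blast
  have "(p \<otimes> k \<oplus> p' \<otimes> m) \<otimes> (a \<otimes> q \<oplus> b \<otimes> q') \<oplus> (p \<otimes> l \<oplus> p' \<otimes> n) \<otimes> (c \<otimes> q \<oplus> d \<otimes> q') =
      p \<otimes> ((k \<otimes> a \<oplus> l \<otimes> c) \<otimes> q \<oplus> (k \<otimes> b \<oplus> l \<otimes> d) \<otimes> q') \<oplus>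
      p' \<otimes> ((m \<otimes> a \<oplus> n \<otimes> c) \<otimes> q \<oplus> (m \<otimes> b \<oplus> n \<otimes> d) \<otimes> q')"
    using assms(1-8) p by algebra
  then show ?thesis
    using p k unfolding e by (intro representsI[of "p \<otimes> k \<oplus> p' \<otimes> m" "p \<otimes> l \<oplus> p' \<otimes> n" q q']) auto
qed

lemma unimodular_row_ops:
  assumes a: "a \<in> carrier R" "b \<in> carrier R" "c \<in> carrier R" "d \<in> carrier R"
    and k: "k \<in> carrier R" "l \<in> carrier R" "m \<in> carrier R" "n \<in> carrier R"
    and det: "k \<otimes> n \<ominus> l \<otimes> m = \<one>" and "unimodular R a b c d"
  shows "unimodular R (k \<otimes> a \<oplus> l \<otimes> c) (k \<otimes> b \<oplus> l \<otimes> d) (m \<otimes> a \<oplus> n \<otimes> c) (m \<otimes> b \<oplus> n \<otimes> d)"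
proof -
  obtain x y z w where x: "x \<in> carrier R" "y \<in> carrier R" "z \<in> carrier R" "w \<in> carrier R"
    "a \<otimes> x \<oplus> b \<otimes> y \<oplus> c \<otimes> z \<oplus> d \<otimes> w = \<one>"
    using assms(10) unfolding unimodular_def by blast
  \<comment> \<open>The Bezout coefficients are transformed by the transposed adjugate, which undoes
    the row operation up to the determinant. Each of the two columns contributes an identity of this
    shape.\<close>
  have col: "(k \<otimes> a \<oplus> l \<otimes> c) \<otimes> (n \<otimes> x \<ominus> m \<otimes> z) \<oplus> (m \<otimes> a \<oplus> n \<otimes> c) \<otimes> (k \<otimes> z \<ominus> l \<otimes> x)
      = (k \<otimes> n \<ominus> l \<otimes> m) \<otimes> (a \<otimes> x \<oplus> c \<otimes> z)"
    if "a \<in> carrier R" "c \<in> carrier R" "x \<in> carrier R" "z \<in> carrier R" for a c x z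
    using that k by algebra
  let ?u = "k \<otimes> a \<oplus> l \<otimes> c" and ?v = "m \<otimes> a \<oplus> n \<otimes> c" and ?u' = "k \<otimes> b \<oplus> l \<otimes> d" and ?v' = "m \<otimes> b \<oplus> n \<otimes> d"
  let ?x = "n \<otimes> x \<ominus> m \<otimes> z" and ?z = "k \<otimes> z \<ominus> l \<otimes> x" and ?y = "n \<otimes> y \<ominus> m \<otimes> w" and ?w = "k \<otimes> w \<ominus> l \<otimes> y"
  have "?u \<otimes> ?x \<oplus> ?u' \<otimes> ?y \<oplus> ?v \<otimes> ?z \<oplus> ?v' \<otimes> ?w = (?u \<otimes> ?x \<oplus> ?v \<otimes> ?z) \<oplus> (?u' \<otimes> ?y \<oplus> ?v' \<otimes> ?w)"
    using a k x(1-4) by (simp add: a_ac)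
  also have "\<dots> = (a \<otimes> x \<oplus> c \<otimes> z) \<oplus> (b \<otimes> y \<oplus> d \<otimes> w)"
    using a x(1-4) by (simp add: col det)
  also have "\<dots> = \<one>"
    unfolding x(5)[symmetric] using a x(1-4) by (simp add: a_ac)
  finally show ?thesis
    using k x(1-4) by (intro unimodularI[of ?x ?y ?z ?w]) auto
qed

lemma represents_col_ops:
  assumes "a \<in> carrier R" "b \<in> carrier R" "c \<in> carrier R" "d \<in> carrier R"
    and "k \<in> carrier R" "l \<in> carrier R" "m \<in> carrier R" "n \<in> carrier R"
    and "represents R (k \<otimes> a \<oplus> l \<otimes> b) (m \<otimes> a \<oplus> n \<otimes> b) (k \<otimes> c \<oplus> l \<otimes> d) (m \<otimes> c \<oplus> n \<otimes> d) t"
  shows "represents R a b c d t"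
  by (rule represents_transpose, (rule assms)+, rule represents_row_ops[of a c b d k l m n])
    (use assms in \<open>auto intro: represents_transpose\<close>)

lemma unimodular_col_ops:
  assumes "a \<in> carrier R" "b \<in> carrier R" "c \<in> carrier R" "d \<in> carrier R"
    and "k \<in> carrier R" "l \<in> carrier R" "m \<in> carrier R" "n \<in> carrier R"
    and "k \<otimes> n \<ominus> l \<otimes> m = \<one>" and "unimodular R a b c d"
  shows "unimodular R (k \<otimes> a \<oplus> l \<otimes> b) (m \<otimes> a \<oplus> n \<otimes> b) (k \<otimes> c \<oplus> l \<otimes> d) (m \<otimes> c \<oplus> n \<otimes> d)"
  using unimodular_transpose[OF _ _ _ _ unimodular_row_ops[OF assms(1,3,2,4,5-9)
      unimodular_transpose[OF assms(1-4,10)]]] assms by auto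

text \<open>Modulo \<open>w\<close> only the row \<open>(g, h)\<close> remains, and it is unimodular
  there. Stable range 1 modulo \<open>w\<close> yields a column \<open>(1, k)\<close> which the
  matrix sends to \<open>(w, g + h k)\<close>, a unimodular column; its Bezout coefficients form the
  required row.\<close>

lemma represents_one_lower_triangular:
  assumes c: "w \<in> carrier R" "g \<in> carrier R" "h \<in> carrier R"
    and sw: "stable_mod R w" and u: "unimodular R w \<zero> g h"
  shows "represents R w \<zero> g h \<one>"
proof -
  obtain x y z v where x: "x \<in> carrier R" "y \<in> carrier R" "z \<in> carrier R" "v \<in> carrier R"
    "w \<otimes> x \<oplus> \<zero> \<otimes> y \<oplus> g \<otimes> z \<oplus> h \<otimes> v = \<one>"
    using u unfolding unimodular_def by blast
  have "g \<otimes> z \<oplus> h \<otimes> v \<oplus> w \<otimes> x = \<one>"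
    using x c by (simp add: a_ac)
  then obtain k where k: "k \<in> carrier R" "comaximal R (g \<oplus> h \<otimes> k) w"
    using x c by (elim stable_modD[OF sw, rotated 5]) auto
  then obtain p q where pq: "p \<in> carrier R" "q \<in> carrier R" "(g \<oplus> h \<otimes> k) \<otimes> p \<oplus> w \<otimes> q = \<one>"
    using c by (auto simp: comaximal_iff)
  have "q \<otimes> (w \<otimes> \<one> \<oplus> \<zero> \<otimes> k) \<oplus> p \<otimes> (g \<otimes> \<one> \<oplus> h \<otimes> k) = (g \<oplus> h \<otimes> k) \<otimes> p \<oplus> w \<otimes> q"
    using c k(1) pq(1,2) by algebra
  then show ?thesis
    using pq k(1) by (intro representsI[of q p \<one> k]) auto
qed

text \<open>The gcd \<open>w\<close> of the first row divides the value \<open>a q + b q'\<close>,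
  so it inherits \<open>stable_mod\<close>, and invertible column operations turn the first row into
  \<open>(w, 0)\<close>.\<close>

lemma represents_one_of_first_row:
  assumes H: gcd_property
    and c: "a \<in> carrier R" "b \<in> carrier R" "c \<in> carrier R" "d \<in> carrier R" "q \<in> carrier R" "q' \<in> carrier R"
    and s: "stable_mod R (a \<otimes> q \<oplus> b \<otimes> q')" and u: "unimodular R a b c d"
  shows "represents R a b c d \<one>"
proof -
  obtain w a' b' x y where w: "w \<in> carrier R" "a' \<in> carrier R" "b' \<in> carrier R" "x \<in> carrier R"
    "y \<in> carrier R" "a = w \<otimes> a'" "b = w \<otimes> b'" "a' \<otimes> x \<oplus> b' \<otimes> y = \<one>"
    using gcd_propertyE[OF H c(1,2)] .
  have "w \<otimes> (a' \<otimes> q \<oplus> b' \<otimes> q') = a \<otimes> q \<oplus> b \<otimes> q'"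
    unfolding w(6,7) using c(5,6) w(1-3) by algebra
  then have sw: "stable_mod R w"
    using s stable_mod_factor[of w "a' \<otimes> q \<oplus> b' \<otimes> q'"] w(1-3) c(5,6) by simp
  \<comment> \<open>The column operations use the columns \<open>(x, y)\<close> and
    \<open>(-b', a')\<close>: the first produces the gcd, the second annihilates the row, and the
    determinant is the Bezout identity of the cofactors.\<close>
  have "x \<otimes> a' \<ominus> y \<otimes> (\<ominus> b') = a' \<otimes> x \<oplus> b' \<otimes> y"
    using w(1-5) by algebra
  then have det: "x \<otimes> a' \<ominus> y \<otimes> (\<ominus> b') = \<one>" unfolding w(8) .
  have "x \<otimes> a \<oplus> y \<otimes> b = w \<otimes> (a' \<otimes> x \<oplus> b' \<otimes> y)"
    unfolding w(6,7) using w(1-5) by algebra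
  then have e1: "x \<otimes> a \<oplus> y \<otimes> b = w" unfolding w(8) using w(1) by simp
  have e2: "(\<ominus> b') \<otimes> a \<oplus> a' \<otimes> b = \<zero>"
    unfolding w(6,7) using w(1-5) by algebra
  let ?g = "x \<otimes> c \<oplus> y \<otimes> d" and ?h = "(\<ominus> b') \<otimes> c \<oplus> a' \<otimes> d"
  have "unimodular R w \<zero> ?g ?h"
    using unimodular_col_ops[OF c(1-4) w(4,5) a_inv_closed[OF w(3)] w(2) det u] unfolding e1 e2 .
  then have "represents R w \<zero> ?g ?h \<one>"
    using c w sw by (intro represents_one_lower_triangular) auto
  then show ?thesis
    using represents_col_ops[OF c(1-4) w(4,5) a_inv_closed[OF w(3)] w(2)] unfolding e1 e2 by blast
qed

text \<open>A unimodular row \<open>(p, p')\<close> is completed by \<open>(-n, m)\<close> to a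
  matrix of determinant 1. After multiplication by it the first row alone takes the given value at
  \<open>(q, q')\<close>.\<close>

lemma represents_one_of_stable_value:
  assumes H: gcd_property
    and c: "a \<in> carrier R" "b \<in> carrier R" "c \<in> carrier R" "d \<in> carrier R"
    and p: "p \<in> carrier R" "p' \<in> carrier R" "comaximal R p p'" and q: "q \<in> carrier R" "q' \<in> carrier R"
    and s: "stable_mod R (p \<otimes> (a \<otimes> q \<oplus> b \<otimes> q') \<oplus> p' \<otimes> (c \<otimes> q \<oplus> d \<otimes> q'))"
    and u: "unimodular R a b c d"
  shows "represents R a b c d \<one>"
proof -
  obtain m n where mn: "m \<in> carrier R" "n \<in> carrier R" "p \<otimes> m \<oplus> p' \<otimes> n = \<one>"
    using p by (auto simp: comaximal_iff)
  have "p \<otimes> m \<ominus> p' \<otimes> (\<ominus> n) = p \<otimes> m \<oplus> p' \<otimes> n"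
    using p(1,2) mn(1,2) by algebra
  then have det: "p \<otimes> m \<ominus> p' \<otimes> (\<ominus> n) = \<one>" unfolding mn(3) .
  note o = c p(1,2) a_inv_closed[OF mn(2)] mn(1)
  have "(p \<otimes> a \<oplus> p' \<otimes> c) \<otimes> q \<oplus> (p \<otimes> b \<oplus> p' \<otimes> d) \<otimes> q' =
      p \<otimes> (a \<otimes> q \<oplus> b \<otimes> q') \<oplus> p' \<otimes> (c \<otimes> q \<oplus> d \<otimes> q')"
    using c p(1,2) q by algebra
  then have "stable_mod R ((p \<otimes> a \<oplus> p' \<otimes> c) \<otimes> q \<oplus> (p \<otimes> b \<oplus> p' \<otimes> d) \<otimes> q')"
    using s by simp
  then have "represents R (p \<otimes> a \<oplus> p' \<otimes> c) (p \<otimes> b \<oplus> p' \<otimes> d)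
      (\<ominus> n \<otimes> a \<oplus> m \<otimes> c) (\<ominus> n \<otimes> b \<oplus> m \<otimes> d) \<one>"
    using unimodular_row_ops[OF o det u] o q by (intro represents_one_of_first_row[OF H _ _ _ _ q]) auto
  then show ?thesis
    by (rule represents_row_ops[OF o])
qed

text \<open>Assumption \<open>sh\<close> is the form in which adequate range 1 is used, once
  adequate elements are known to satisfy \<open>stable_mod\<close>. It supplies a stable value at a
  unimodular row.\<close>

lemma represents_one_of_stable_shift:
  assumes H: gcd_property
    and sh: "\<And>x y. \<lbrakk>x \<in> carrier R; y \<in> carrier R; comaximal R x y\<rbrakk> \<Longrightarrow> \<exists>k\<in>carrier R. stable_mod R (x \<oplus> y \<otimes> k)"
    and c: "a \<in> carrier R" "b \<in> carrier R" "c \<in> carrier R" "d \<in> carrier R"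
    and u: "unimodular R a b c d"
  shows "represents R a b c d \<one>"
proof -
  obtain w a' b' x y where w: "w \<in> carrier R" "a' \<in> carrier R" "b' \<in> carrier R" "x \<in> carrier R"
    "y \<in> carrier R" "a = w \<otimes> a'" "b = w \<otimes> b'" "a' \<otimes> x \<oplus> b' \<otimes> y = \<one>"
    using gcd_propertyE[OF H c(1,2)] .
  have "x \<otimes> a' \<ominus> y \<otimes> (\<ominus> b') = a' \<otimes> x \<oplus> b' \<otimes> y"
    using w(1-5) by algebra
  then have det: "x \<otimes> a' \<ominus> y \<otimes> (\<ominus> b') = \<one>" unfolding w(8) .
  have "x \<otimes> a \<oplus> y \<otimes> b = w \<otimes> (a' \<otimes> x \<oplus> b' \<otimes> y)"
    unfolding w(6,7) using w(1-5) by algebra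
  then have e1: "x \<otimes> a \<oplus> y \<otimes> b = w" unfolding w(8) using w(1) by simp
  have e2: "(\<ominus> b') \<otimes> a \<oplus> a' \<otimes> b = \<zero>"
    unfolding w(6,7) using w(1-5) by algebra
  \<comment> \<open>The matrix is now lower triangular with rows \<open>(w, 0)\<close> and \<open>(g, h)\<close>. Adding multiples of \<open>w\<close>
    and \<open>h\<close> to \<open>g\<close> makes it an element modulo which the ring has stable range 1.\<close>
  define g where "g = x \<otimes> c \<oplus> y \<otimes> d"
  define h where "h = (\<ominus> b') \<otimes> c \<oplus> a' \<otimes> d"
  have gh: "g \<in> carrier R" "h \<in> carrier R" unfolding g_def h_def using c w by auto
  have un: "unimodular R w \<zero> g h"
    using unimodular_col_ops[OF c(1-4) w(4,5) a_inv_closed[OF w(3)] w(2) det u]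
    unfolding e1 e2 g_def h_def .
  then obtain r r' s t where r: "r \<in> carrier R" "r' \<in> carrier R" "s \<in> carrier R" "t \<in> carrier R"
    "w \<otimes> r \<oplus> \<zero> \<otimes> r' \<oplus> g \<otimes> s \<oplus> h \<otimes> t = \<one>"
    unfolding unimodular_def by blast
  \<comment> \<open>Grouping the Bezout identity of the entries around \<open>g\<close> makes
    \<open>w r + h t\<close> the comaximal partner of \<open>g\<close>; the coefficients
    \<open>r\<close> and \<open>t\<close> record how that partner is built from \<open>w\<close> and
    \<open>h\<close>.\<close>
  have "g \<otimes> s \<oplus> (w \<otimes> r \<oplus> h \<otimes> t) \<otimes> \<one> = w \<otimes> r \<oplus> \<zero> \<otimes> r' \<oplus> g \<otimes> s \<oplus> h \<otimes> t"
    using gh r(1-4) w(1) by algebra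
  then have "comaximal R g (w \<otimes> r \<oplus> h \<otimes> t)"
    unfolding r(5) using gh r(1-4) w(1) by (intro comaximal_ofI[of _ _ s \<one>]) auto
  then obtain k where k: "k \<in> carrier R" "stable_mod R (g \<oplus> (w \<otimes> r \<oplus> h \<otimes> t) \<otimes> k)"
    using sh[of g "w \<otimes> r \<oplus> h \<otimes> t"] gh r w(1) by auto
  \<comment> \<open>The shifted element is the value at the row \<open>(r k, 1)\<close> and the
    column \<open>(1, t k)\<close>. The entry 1 makes this row unimodular.\<close>
  have "(r \<otimes> k) \<otimes> (w \<otimes> \<one> \<oplus> \<zero> \<otimes> (t \<otimes> k)) \<oplus> \<one> \<otimes> (g \<otimes> \<one> \<oplus> h \<otimes> (t \<otimes> k)) =
      g \<oplus> (w \<otimes> r \<oplus> h \<otimes> t) \<otimes> k"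
    using gh r(1-4) w(1) k(1) by algebra
  then have "stable_mod R ((r \<otimes> k) \<otimes> (w \<otimes> \<one> \<oplus> \<zero> \<otimes> (t \<otimes> k)) \<oplus> \<one> \<otimes> (g \<otimes> \<one> \<oplus> h \<otimes> (t \<otimes> k)))"
    using k(2) by simp
  moreover have "comaximal R (r \<otimes> k) \<one>"
    using r k by (intro comaximal_ofI[of _ _ \<zero> \<one>]) auto
  ultimately have "represents R w \<zero> g h \<one>"
    using un w(1) gh r k(1)
    by (intro represents_one_of_stable_value[OF H, of _ _ _ _ "r \<otimes> k" \<one> \<one> "t \<otimes> k"]) auto
  then show ?thesis
    using represents_col_ops[OF c(1-4) w(4,5) a_inv_closed[OF w(3)] w(2)]
    unfolding e1 e2 g_def h_def by blast
qed

lemma represents_scale: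
  assumes "a \<in> carrier R" "b \<in> carrier R" "c \<in> carrier R" "d \<in> carrier R" "g \<in> carrier R"
    "t \<in> carrier R" "represents R a b c d t"
  shows "represents R (g \<otimes> a) (g \<otimes> b) (g \<otimes> c) (g \<otimes> d) (g \<otimes> t)"
proof -
  obtain p p' q q' where p: "p \<in> carrier R" "p' \<in> carrier R" "q \<in> carrier R" "q' \<in> carrier R"
    "p \<otimes> (a \<otimes> q \<oplus> b \<otimes> q') \<oplus> p' \<otimes> (c \<otimes> q \<oplus> d \<otimes> q') = t"
    using assms unfolding represents_def by blast
  have "p \<otimes> (g \<otimes> a \<otimes> q \<oplus> g \<otimes> b \<otimes> q') \<oplus> p' \<otimes> (g \<otimes> c \<otimes> q \<oplus> g \<otimes> d \<otimes> q') = g \<otimes> t"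
    unfolding p(5)[symmetric] using assms(1-5) p(1-4) by algebra
  then show ?thesis
    using p by (intro representsI[of p p' q q']) auto
qed

end

section \<open>Bilinear forms and localization\<close>

context mult_closed
begin

lemma localization_common_denominator:
  assumes "x \<in> carrier (localization R S)" "y \<in> carrier (localization R S)"
  obtains a b s where "a \<in> carrier R" "b \<in> carrier R" "s \<in> S" "x = fraction R S a s" "y = fraction R S b s"
proof -
  obtain a s where a: "a \<in> carrier R" "s \<in> S" "x = fraction R S a s"
    using assms(1) by (elim localization_carrierE)
  obtain b t where b: "b \<in> carrier R" "t \<in> S" "y = fraction R S b t"
    using assms(2) by (elim localization_carrierE)
  have "x = fraction R S (a \<otimes> t) (s \<otimes> t)" "y = fraction R S (b \<otimes> s) (s \<otimes> t)"
    unfolding a(3) b(3) using a b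
    by (intro fraction_eqI; auto simp: mult_S S_closed m_ac)+
  then show ?thesis
    using a b that[of "a \<otimes> t" "b \<otimes> s" "s \<otimes> t"] by (auto simp: mult_S S_closed)
qed

lemma unimodular_localization:
  assumes c: "a \<in> carrier R" "b \<in> carrier R" "c \<in> carrier R" "d \<in> carrier R" and "unimodular R a b c d"
  shows "unimodular (localization R S) (fraction R S a \<one>) (fraction R S b \<one>)
    (fraction R S c \<one>) (fraction R S d \<one>)"
proof -
  interpret L: cring "localization R S" by (rule cring_localization)
  obtain x y z w where x: "x \<in> carrier R" "y \<in> carrier R" "z \<in> carrier R" "w \<in> carrier R"
    "a \<otimes> x \<oplus> b \<otimes> y \<oplus> c \<otimes> z \<oplus> d \<otimes> w = \<one>"
    using assms unfolding unimodular_def by blast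
  show ?thesis
    using x(1-4)
    by (intro L.unimodularI[of "fraction R S x \<one>" "fraction R S y \<one>" "fraction R S z \<one>" "fraction R S w \<one>"])
      (simp_all add: fraction_in_carrier one_S c localization_mult_fraction localization_add_fraction
        localization_one x(5))
qed

text \<open>The numerators of \<open>p\<close> and \<open>q\<close> serve as vectors over
  \<open>R\<close>. All denominators, together with the multiplier from equality of fractions, go
  into the row and into the value, which is therefore a product of elements of
  \<open>S\<close>.\<close>

lemma represents_of_localization:
  assumes c: "a \<in> carrier R" "b \<in> carrier R" "c \<in> carrier R" "d \<in> carrier R"
    and "represents (localization R S) (fraction R S a \<one>) (fraction R S b \<one>)
      (fraction R S c \<one>) (fraction R S d \<one>) \<one>\<^bsub>localization R S\<^esub>"
  shows "\<exists>t\<in>S. represents R a b c d t"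
proof -
  let ?L = "localization R S"
  obtain p p' q q' where p: "p \<in> carrier ?L" "p' \<in> carrier ?L" "q \<in> carrier ?L" "q' \<in> carrier ?L"
    and e: "p \<otimes>\<^bsub>?L\<^esub> (fraction R S a \<one> \<otimes>\<^bsub>?L\<^esub> q \<oplus>\<^bsub>?L\<^esub> fraction R S b \<one> \<otimes>\<^bsub>?L\<^esub> q') \<oplus>\<^bsub>?L\<^esub>
      p' \<otimes>\<^bsub>?L\<^esub> (fraction R S c \<one> \<otimes>\<^bsub>?L\<^esub> q \<oplus>\<^bsub>?L\<^esub> fraction R S d \<one> \<otimes>\<^bsub>?L\<^esub> q') = \<one>\<^bsub>?L\<^esub>"
    using assms(5) unfolding represents_def by blast
  obtain x x' s where x: "x \<in> carrier R" "x' \<in> carrier R" "s \<in> S" "p = fraction R S x s" "p' = fraction R S x' s"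
    using localization_common_denominator[OF p(1,2)] .
  obtain y y' t where y: "y \<in> carrier R" "y' \<in> carrier R" "t \<in> S" "q = fraction R S y t" "q' = fraction R S y' t"
    using localization_common_denominator[OF p(3,4)] .
  have st: "s \<in> carrier R" "t \<in> carrier R" using x y S_closed by auto
  let ?n = "x \<otimes> (a \<otimes> y \<otimes> t \<oplus> b \<otimes> y' \<otimes> t) \<otimes> (s \<otimes> (t \<otimes> t)) \<oplus> x' \<otimes> (c \<otimes> y \<otimes> t \<oplus> d \<otimes> y' \<otimes> t) \<otimes> (s \<otimes> (t \<otimes> t))"
  let ?d = "s \<otimes> (t \<otimes> t) \<otimes> (s \<otimes> (t \<otimes> t))"
  have "fraction R S ?n ?d = fraction R S \<one> \<one>"
    using e x y c st unfolding localization_one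
    by (simp add: localization_mult_fraction localization_add_fraction mult_S one_S)
  then obtain u where u: "u \<in> S" "u \<otimes> (?n \<otimes> \<one>) = u \<otimes> (\<one> \<otimes> ?d)"
    using fraction_eq_iff[of ?n ?d \<one> \<one>] x y c st by (auto simp: mult_S one_S)
  \<comment> \<open>The common factor of both summands of \<open>u ?n\<close>: one \<open>t\<close>
    from inside each bracket and \<open>s t t\<close> from the addition of fractions.\<close>
  let ?k = "u \<otimes> s \<otimes> t \<otimes> t \<otimes> t"
  have "(?k \<otimes> x) \<otimes> (a \<otimes> y \<oplus> b \<otimes> y') \<oplus> (?k \<otimes> x') \<otimes> (c \<otimes> y \<oplus> d \<otimes> y') = u \<otimes> (?n \<otimes> \<one>)"
    using x(1,2) y(1,2) c st S_closed[OF u(1)] by algebra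
  moreover have "u \<otimes> (\<one> \<otimes> ?d) \<in> S"
    using u(1) x(3) y(3) st by (simp add: mult_S)
  ultimately show ?thesis
    unfolding u(2) using x(1,2) y(1,2) st S_closed[OF u(1)]
    by (intro bexI[of _ "u \<otimes> (\<one> \<otimes> ?d)"] representsI[of "?k \<otimes> x" "?k \<otimes> x'" y y']) auto
qed

end

section \<open>The value 1 over \<open>R\<close>, and values equal to the content\<close>

context cring
begin

lemma represents_one:
  assumes H: gcd_property and ad: "adequate_range_1 (localization R (loc_stable_range_1_set R))"
    and c: "a \<in> carrier R" "b \<in> carrier R" "c \<in> carrier R" "d \<in> carrier R" and u: "unimodular R a b c d"
  shows "represents R a b c d \<one>"
proof -
  interpret T: mult_closed R "loc_stable_range_1_set R"
    by (rule mult_closed_loc_stable_range_1_set)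
  interpret L: cring "localization R (loc_stable_range_1_set R)"
    by (rule T.cring_localization)
  have "\<exists>t\<in>loc_stable_range_1_set R. represents R a b c d t"
  proof (rule T.represents_of_localization[OF c], rule L.represents_one_of_stable_shift)
    show "L.gcd_property" by (rule T.gcd_property_localization[OF H])
    \<comment> \<open>Adequate range 1 provides an adequate shift, and the gcd property of the
      localization makes adequacy imply \<open>stable_mod\<close> there.\<close>
    then show "\<exists>k\<in>carrier (localization R (loc_stable_range_1_set R)).
        stable_mod (localization R (loc_stable_range_1_set R))
          (x \<oplus>\<^bsub>localization R (loc_stable_range_1_set R)\<^esub> y \<otimes>\<^bsub>localization R (loc_stable_range_1_set R)\<^esub> k)"
      if "x \<in> carrier (localization R (loc_stable_range_1_set R))"
        "y \<in> carrier (localization R (loc_stable_range_1_set R))"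
        "comaximal (localization R (loc_stable_range_1_set R)) x y" for x y
      using ad[unfolded adequate_range_1_def, rule_format, OF that] that(1,2)
        L.stable_mod_adequate by (meson L.a_closed L.m_closed)
  qed (use c u in \<open>auto intro!: T.fraction_in_carrier T.one_S T.unimodular_localization\<close>)
  then obtain t where t: "t \<in> carrier R" "stable_mod R t" "represents R a b c d t"
    by (auto simp: loc_stable_range_1_set_eq)
  then obtain p p' q q' where p: "p \<in> carrier R" "p' \<in> carrier R" "q \<in> carrier R" "q' \<in> carrier R"
    "p \<otimes> (a \<otimes> q \<oplus> b \<otimes> q') \<oplus> p' \<otimes> (c \<otimes> q \<oplus> d \<otimes> q') = t"
    unfolding represents_def by blast
  \<comment> \<open>The row may have lost unimodularity when denominators were cleared. Its
    primitive part \<open>(r, r')\<close> takes the value \<open>?v\<close> with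
    \<open>?v h = t\<close>, and a divisor of an element of T is again stable.\<close>
  obtain h r r' x y where h: "h \<in> carrier R" "r \<in> carrier R" "r' \<in> carrier R" "x \<in> carrier R"
    "y \<in> carrier R" "p = h \<otimes> r" "p' = h \<otimes> r'" "r \<otimes> x \<oplus> r' \<otimes> y = \<one>"
    using gcd_propertyE[OF H p(1,2)] .
  let ?v = "r \<otimes> (a \<otimes> q \<oplus> b \<otimes> q') \<oplus> r' \<otimes> (c \<otimes> q \<oplus> d \<otimes> q')"
  have v: "?v \<in> carrier R" using h p c by simp
  have "?v \<otimes> h = t"
    unfolding p(5)[symmetric] h(6,7) using c h(1-3) p(3,4) by algebra
  then have "stable_mod R ?v"
    using stable_mod_factor[OF v h(1)] t(2) by simp
  then show ?thesis
    using h c p(3,4) u by (intro represents_one_of_stable_value[OF H, of _ _ _ _ r r' q q'] comaximal_ofI[of r r' x y]) auto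
qed

lemma divides_mult_self: "\<lbrakk>a \<in> carrier R; b \<in> carrier R\<rbrakk> \<Longrightarrow> a divides (a \<otimes> b)"
  by (rule dividesI) auto

text \<open>Gcds of the rows, and then of these gcds, extract the content \<open>t\<close> and leave
  a unimodular matrix. That matrix represents 1, and scaling by \<open>t\<close> returns to the
  original one.\<close>

lemma represents_common_divisor:
  assumes H: gcd_property and ad: "adequate_range_1 (localization R (loc_stable_range_1_set R))"
    and c: "a \<in> carrier R" "b \<in> carrier R" "c \<in> carrier R" "d \<in> carrier R"
  obtains t where "t \<in> carrier R" "represents R a b c d t" "t divides a" "t divides b" "t divides c" "t divides d"
proof -
  obtain g a' b' x y where g: "g \<in> carrier R" "a' \<in> carrier R" "b' \<in> carrier R" "x \<in> carrier R"
    "y \<in> carrier R" "a = g \<otimes> a'" "b = g \<otimes> b'" "a' \<otimes> x \<oplus> b' \<otimes> y = \<one>"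
    using gcd_propertyE[OF H c(1,2)] .
  obtain h c' d' z w where h: "h \<in> carrier R" "c' \<in> carrier R" "d' \<in> carrier R" "z \<in> carrier R"
    "w \<in> carrier R" "c = h \<otimes> c'" "d = h \<otimes> d'" "c' \<otimes> z \<oplus> d' \<otimes> w = \<one>"
    using gcd_propertyE[OF H c(3,4)] .
  obtain t g' h' u v where t: "t \<in> carrier R" "g' \<in> carrier R" "h' \<in> carrier R" "u \<in> carrier R"
    "v \<in> carrier R" "g = t \<otimes> g'" "h = t \<otimes> h'" "g' \<otimes> u \<oplus> h' \<otimes> v = \<one>"
    using gcd_propertyE[OF H g(1) h(1)] .
  have e: "a = t \<otimes> (g' \<otimes> a')" "b = t \<otimes> (g' \<otimes> b')" "c = t \<otimes> (h' \<otimes> c')" "d = t \<otimes> (h' \<otimes> d')"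
    unfolding g(6,7) h(6,7) t(6,7) using g(2,3) h(2,3) t(1-3) by (simp_all add: m_assoc)
  \<comment> \<open>The identity for \<open>g'\<close> and \<open>h'\<close> is refined by the
    Bezout identities of the two rows, so the four reduced entries are jointly comaximal.\<close>
  have "(g' \<otimes> a') \<otimes> (x \<otimes> u) \<oplus> (g' \<otimes> b') \<otimes> (y \<otimes> u) \<oplus> (h' \<otimes> c') \<otimes> (z \<otimes> v) \<oplus> (h' \<otimes> d') \<otimes> (w \<otimes> v) =
    g' \<otimes> u \<otimes> (a' \<otimes> x \<oplus> b' \<otimes> y) \<oplus> h' \<otimes> v \<otimes> (c' \<otimes> z \<oplus> d' \<otimes> w)"
    using g(2-5) h(2-5) t(2-5) by algebra
  then have "unimodular R (g' \<otimes> a') (g' \<otimes> b') (h' \<otimes> c') (h' \<otimes> d')"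
    unfolding g(8) h(8) using g(2-5) h(2-5) t
    by (intro unimodularI[of "x \<otimes> u" "y \<otimes> u" "z \<otimes> v" "w \<otimes> v"]) auto
  then have "represents R (g' \<otimes> a') (g' \<otimes> b') (h' \<otimes> c') (h' \<otimes> d') \<one>"
    using g(2,3) h(2,3) t(2,3) by (intro represents_one[OF H ad]) auto
  then have "represents R a b c d (t \<otimes> \<one>)"
    unfolding e using g(2,3) h(2,3) t(1-3) by (intro represents_scale) auto
  then show ?thesis
    using that[of t] t(1) e g(2,3) h(2,3) t(2,3) divides_mult_self by simp
qed

end

section \<open>Matrices and diagonal reduction\<close>

definition identity_matrix :: "('a, 'm) ring_scheme \<Rightarrow> nat \<Rightarrow> nat \<Rightarrow> 'a" where
  "identity_matrix R = (\<lambda>i j. if i = j then \<one>\<^bsub>R\<^esub> else \<zero>\<^bsub>R\<^esub>)"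

text \<open>\<open>r\<close> and \<open>c\<close> are the dimensions of \<open>X\<close>; those of
  \<open>Y\<close> are left open, as for every matrix in this encoding. Indices of \<open>Y\<close>
  are shifted back to start at 0.\<close>

definition block_diag ::
  "('a, 'm) ring_scheme \<Rightarrow> nat \<Rightarrow> nat \<Rightarrow> (nat \<Rightarrow> nat \<Rightarrow> 'a) \<Rightarrow> (nat \<Rightarrow> nat \<Rightarrow> 'a) \<Rightarrow> nat \<Rightarrow> nat \<Rightarrow> 'a" where
  "block_diag R r c X Y = (\<lambda>i j.
    if i < r then if j < c then X i j else \<zero>\<^bsub>R\<^esub>
    else if j < c then \<zero>\<^bsub>R\<^esub> else Y (i - r) (j - c))"

text \<open>The identity plus the column \<open>v\<close> times the row
  \<open>(1, 0, ..., 0)\<close>; as a left factor it adds \<open>v i\<close> times row 0 to row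
  \<open>i\<close>.\<close>

definition first_row_adder :: "('a, 'm) ring_scheme \<Rightarrow> (nat \<Rightarrow> 'a) \<Rightarrow> nat \<Rightarrow> nat \<Rightarrow> 'a" where
  "first_row_adder R v = (\<lambda>i j. identity_matrix R i j \<oplus>\<^bsub>R\<^esub> v i \<otimes>\<^bsub>R\<^esub> identity_matrix R 0 j)"

definition transposed :: "(nat \<Rightarrow> nat \<Rightarrow> 'a) \<Rightarrow> nat \<Rightarrow> nat \<Rightarrow> 'a" where
  "transposed A = (\<lambda>i j. A j i)"

section \<open>Finite sums and matrix products\<close>

context cring
begin

abbreviation mm where "mm \<equiv> matrix_mult R"

lemma matricesD: "A \<in> matrices R m n \<Longrightarrow> i < m \<Longrightarrow> j < n \<Longrightarrow> A i j \<in> carrier R"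
  unfolding matrices_def by blast

lemma matricesI: "(\<And>i j. i < m \<Longrightarrow> j < n \<Longrightarrow> A i j \<in> carrier R) \<Longrightarrow> A \<in> matrices R m n"
  unfolding matrices_def by blast

lemma finsum_closed': "(\<And>l. l < k \<Longrightarrow> f l \<in> carrier R) \<Longrightarrow> (\<Oplus>l\<in>{..<k::nat}. f l) \<in> carrier R"
  by (rule finsum_closed) auto

lemma finsum_lessThan_cong:
  "(\<And>l. l < k \<Longrightarrow> g l \<in> carrier R) \<Longrightarrow> (\<And>l. l < k \<Longrightarrow> f l = g l) \<Longrightarrow>
    (\<Oplus>l\<in>{..<k::nat}. f l) = (\<Oplus>l\<in>{..<k}. g l)"
  by (rule finsum_cong') auto

lemma finsum_lessThan_Suc:
  "(\<And>l. l < Suc k \<Longrightarrow> f l \<in> carrier R) \<Longrightarrow> (\<Oplus>l\<in>{..<Suc k}. f l) = (\<Oplus>l\<in>{..<k}. f l) \<oplus> f k"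
  by (simp add: lessThan_Suc finsum_insert Pi_def a_comm finsum_closed')

lemma finsum_lessThan_add:
  "(\<And>l. l < k + m \<Longrightarrow> f l \<in> carrier R) \<Longrightarrow>
    (\<Oplus>l\<in>{..<k + m::nat}. f l) = (\<Oplus>l\<in>{..<k}. f l) \<oplus> (\<Oplus>l\<in>{..<m}. f (k + l))"
  by (induction m) (simp_all add: finsum_lessThan_Suc finsum_closed' a_assoc)

lemma finsum_lessThan_plus:
  "(\<And>l. l < k \<Longrightarrow> f l \<in> carrier R) \<Longrightarrow> (\<And>l. l < k \<Longrightarrow> g l \<in> carrier R) \<Longrightarrow>
    (\<Oplus>l\<in>{..<k::nat}. f l \<oplus> g l) = (\<Oplus>l\<in>{..<k}. f l) \<oplus> (\<Oplus>l\<in>{..<k}. g l)"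
  by (rule finsum_addf) auto

lemma finsum_lessThan_ldistr:
  "a \<in> carrier R \<Longrightarrow> (\<And>l. l < k \<Longrightarrow> f l \<in> carrier R) \<Longrightarrow>
    (\<Oplus>l\<in>{..<k::nat}. f l) \<otimes> a = (\<Oplus>l\<in>{..<k}. f l \<otimes> a)"
  by (rule finsum_ldistr) auto

lemma finsum_lessThan_rdistr:
  "a \<in> carrier R \<Longrightarrow> (\<And>l. l < k \<Longrightarrow> f l \<in> carrier R) \<Longrightarrow>
    a \<otimes> (\<Oplus>l\<in>{..<k::nat}. f l) = (\<Oplus>l\<in>{..<k}. a \<otimes> f l)"
  by (rule finsum_rdistr) auto

lemma finsum_lessThan_zero: "(\<And>l. l < k \<Longrightarrow> f l = \<zero>) \<Longrightarrow> (\<Oplus>l\<in>{..<k::nat}. f l) = \<zero>"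
  by (subst finsum_lessThan_cong[of k "\<lambda>_. \<zero>"]) auto

lemma finsum_lessThan_swap:
  "(\<And>i j. i < m \<Longrightarrow> j < n \<Longrightarrow> f i j \<in> carrier R) \<Longrightarrow>
    (\<Oplus>i\<in>{..<m::nat}. \<Oplus>j\<in>{..<n::nat}. f i j) = (\<Oplus>j\<in>{..<n}. \<Oplus>i\<in>{..<m}. f i j)"
proof (induction m)
  case 0
  then show ?case by simp
next
  case (Suc m)
  have "(\<Oplus>i\<in>{..<Suc m}. \<Oplus>j\<in>{..<n}. f i j) =
      (\<Oplus>j\<in>{..<n}. \<Oplus>i\<in>{..<m}. f i j) \<oplus> (\<Oplus>j\<in>{..<n}. f m j)"
    using Suc by (subst finsum_lessThan_Suc) (auto intro: finsum_closed')
  also have "\<dots> = (\<Oplus>j\<in>{..<n}. (\<Oplus>i\<in>{..<m}. f i j) \<oplus> f m j)"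
    using Suc.prems by (intro finsum_lessThan_plus[symmetric]) (auto intro: finsum_closed')
  also have "\<dots> = (\<Oplus>j\<in>{..<n}. \<Oplus>i\<in>{..<Suc m}. f i j)"
    using Suc.prems by (intro finsum_lessThan_cong) (auto simp: finsum_lessThan_Suc intro: finsum_closed')
  finally show ?case .
qed

lemma finsum_lessThan_delta:
  assumes "\<And>l. l < k \<Longrightarrow> f l \<in> carrier R" "i < k"
  shows "(\<Oplus>l\<in>{..<k::nat}. if i = l then f l else \<zero>) = f i"
  using assms finsum_singleton[of i "{..<k}" f] by auto

lemma divides_finsum:
  assumes d: "d \<in> carrier R"
  shows "(\<And>l. l < k \<Longrightarrow> f l \<in> carrier R) \<Longrightarrow> (\<And>l. l < k \<Longrightarrow> d divides f l) \<Longrightarrow>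
    d divides (\<Oplus>l\<in>{..<k::nat}. f l)"
proof (induction k)
  case 0
  then show ?case using d by (auto intro: dividesI[of \<zero>])
next
  case (Suc k)
  have "d divides (\<Oplus>l\<in>{..<k}. f l)" "d divides f k"
    using Suc by auto
  then obtain u v where "u \<in> carrier R" "v \<in> carrier R"
      "(\<Oplus>l\<in>{..<k}. f l) = d \<otimes> u" "f k = d \<otimes> v"
    unfolding factor_def by blast
  then show ?case
    using Suc.prems d by (intro dividesI[of "u \<oplus> v"]) (auto simp: finsum_lessThan_Suc r_distr)
qed

lemma divides_mult:
  assumes "d divides a" "d \<in> carrier R" "b \<in> carrier R"
  shows "d divides (a \<otimes> b)" "d divides (b \<otimes> a)"
proof -
  obtain c where c: "c \<in> carrier R" "a = d \<otimes> c"
    using assms(1) unfolding factor_def by blast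
  show "d divides (a \<otimes> b)" "d divides (b \<otimes> a)"
    unfolding c(2) using assms(2,3) c(1)
    by (auto intro!: dividesI[of "c \<otimes> b"] simp: m_assoc m_comm m_lcomm)
qed

lemma mm_closed:
  assumes "A \<in> matrices R m k" "B \<in> matrices R k n"
  shows "mm k A B \<in> matrices R m n"
  unfolding matrix_mult_def using assms[THEN matricesD]
  by (intro matricesI finsum_closed' m_closed)

text \<open>Matrices are compared only on meaningful entries, so an equation between them cannot be
  rewritten inside a product; this congruence takes the place of substitution.\<close>

lemma mm_cong:
  assumes "A' \<in> matrices R m k" "B' \<in> matrices R k n" "i < m" "j < n"
    "\<And>l. l < k \<Longrightarrow> A i l = A' i l" "\<And>l. l < k \<Longrightarrow> B l j = B' l j"
  shows "mm k A B i j = mm k A' B' i j"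
  unfolding matrix_mult_def using assms(3-) assms(1,2)[THEN matricesD]
  by (intro finsum_lessThan_cong) auto

lemma mm_assoc:
  assumes "A \<in> matrices R m k" "B \<in> matrices R k l" "C \<in> matrices R l n" "i < m" "j < n"
  shows "mm l (mm k A B) C i j = mm k A (mm l B C) i j"
proof -
  note c = assms(1-3)[THEN matricesD] assms(4,5)
  have "mm l (mm k A B) C i j = (\<Oplus>y\<in>{..<l}. \<Oplus>x\<in>{..<k}. A i x \<otimes> B x y \<otimes> C y j)"
    unfolding matrix_mult_def using c
    by (intro finsum_lessThan_cong finsum_lessThan_ldistr finsum_closed') auto
  also have "\<dots> = (\<Oplus>x\<in>{..<k}. \<Oplus>y\<in>{..<l}. A i x \<otimes> B x y \<otimes> C y j)"
    using c by (intro finsum_lessThan_swap) auto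
  also have "\<dots> = mm k A (mm l B C) i j"
    unfolding matrix_mult_def using c
    by (intro finsum_lessThan_cong)
      (auto intro!: finsum_closed' finsum_lessThan_cong simp: m_assoc finsum_lessThan_rdistr)
  finally show ?thesis .
qed

lemma identity_matrix_closed [simp]: "identity_matrix R \<in> matrices R m n"
  by (rule matricesI) (simp add: identity_matrix_def)

lemma mm_identity_left:
  assumes "A \<in> matrices R m n" "i < m" "j < n"
  shows "mm m (identity_matrix R) A i j = A i j"
proof -
  have "mm m (identity_matrix R) A i j = (\<Oplus>l\<in>{..<m}. if i = l then A l j else \<zero>)"
    unfolding matrix_mult_def identity_matrix_def using assms matricesD[OF assms(1)]
    by (intro finsum_lessThan_cong) auto
  also have "\<dots> = A i j"
    using assms matricesD[OF assms(1)] by (intro finsum_lessThan_delta) auto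
  finally show ?thesis .
qed

lemma mm_identity_right:
  assumes "A \<in> matrices R m n" "i < m" "j < n"
  shows "mm n A (identity_matrix R) i j = A i j"
proof -
  have "mm n A (identity_matrix R) i j = (\<Oplus>l\<in>{..<n}. if j = l then A i l else \<zero>)"
    unfolding matrix_mult_def identity_matrix_def using assms matricesD[OF assms(1)]
    by (intro finsum_lessThan_cong) auto
  also have "\<dots> = A i j"
    using assms matricesD[OF assms(1)] by (intro finsum_lessThan_delta) auto
  finally show ?thesis .
qed

lemma mm_transposed:
  assumes "A \<in> matrices R m k" "B \<in> matrices R k n" "i < n" "j < m"
  shows "mm k (transposed B) (transposed A) i j = mm k A B j i"
  unfolding matrix_mult_def transposed_def using assms(3,4) assms(1,2)[THEN matricesD]
  by (intro finsum_lessThan_cong) (auto simp: m_comm)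

lemma transposed_closed: "A \<in> matrices R m n \<Longrightarrow> transposed A \<in> matrices R n m"
  unfolding matrices_def transposed_def by blast

lemma transposed_transposed [simp]: "transposed (transposed A) = A"
  by (simp add: transposed_def)

section \<open>Invertible matrices and completion of rows\<close>

lemma general_linearI:
  assumes "P \<in> matrices R n n" "Q \<in> matrices R n n"
    "\<And>i j. i < n \<Longrightarrow> j < n \<Longrightarrow> mm n P Q i j = identity_matrix R i j"
    "\<And>i j. i < n \<Longrightarrow> j < n \<Longrightarrow> mm n Q P i j = identity_matrix R i j"
  shows "P \<in> general_linear R n"
  using assms unfolding general_linear_def identity_matrix_def by blast

lemma general_linearE:
  assumes "P \<in> general_linear R n"
  obtains Q where "P \<in> matrices R n n" "Q \<in> matrices R n n"
    "\<And>i j. i < n \<Longrightarrow> j < n \<Longrightarrow> mm n P Q i j = identity_matrix R i j"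
    "\<And>i j. i < n \<Longrightarrow> j < n \<Longrightarrow> mm n Q P i j = identity_matrix R i j"
  using assms unfolding general_linear_def identity_matrix_def by blast

lemma general_linear_closed: "P \<in> general_linear R n \<Longrightarrow> P \<in> matrices R n n"
  unfolding general_linear_def by blast

lemma general_linear_identity: "identity_matrix R \<in> general_linear R n"
  by (rule general_linearI[of _ _ "identity_matrix R"]) (auto simp: mm_identity_left[of _ n n])

lemma mm_mult_inverse:
  assumes "P \<in> matrices R n n" "P' \<in> matrices R n n" "Q \<in> matrices R n n" "Q' \<in> matrices R n n"
    and "\<And>i j. i < n \<Longrightarrow> j < n \<Longrightarrow> mm n P P' i j = identity_matrix R i j"
    and "\<And>i j. i < n \<Longrightarrow> j < n \<Longrightarrow> mm n Q Q' i j = identity_matrix R i j"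
    and ij: "i < n" "j < n"
  shows "mm n (mm n P Q) (mm n Q' P') i j = identity_matrix R i j"
proof -
  have "mm n (mm n P Q) (mm n Q' P') i j = mm n P (mm n Q (mm n Q' P')) i j"
    using assms by (intro mm_assoc[of _ n]) (auto intro: mm_closed)
  also have "\<dots> = mm n P P' i j"
  proof (rule mm_cong[of _ n _ _ n])
    fix l assume l: "l < n"
    have "mm n Q (mm n Q' P') l j = mm n (mm n Q Q') P' l j"
      using assms l by (intro mm_assoc[of _ n, symmetric]) auto
    also have "\<dots> = mm n (identity_matrix R) P' l j"
      using assms l by (intro mm_cong[of _ n _ _ n]) auto
    also have "\<dots> = P' l j"
      using assms l by (intro mm_identity_left) auto
    finally show "mm n Q (mm n Q' P') l j = P' l j" .
  qed (use assms in auto)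
  finally show ?thesis using assms(5) ij by simp
qed

lemma general_linear_mult:
  assumes "P \<in> general_linear R n" "Q \<in> general_linear R n"
  shows "mm n P Q \<in> general_linear R n"
proof -
  obtain P' where P: "P \<in> matrices R n n" "P' \<in> matrices R n n"
    "\<And>i j. i < n \<Longrightarrow> j < n \<Longrightarrow> mm n P P' i j = identity_matrix R i j"
    "\<And>i j. i < n \<Longrightarrow> j < n \<Longrightarrow> mm n P' P i j = identity_matrix R i j"
    using general_linearE[OF assms(1)] by blast
  obtain Q' where Q: "Q \<in> matrices R n n" "Q' \<in> matrices R n n"
    "\<And>i j. i < n \<Longrightarrow> j < n \<Longrightarrow> mm n Q Q' i j = identity_matrix R i j"
    "\<And>i j. i < n \<Longrightarrow> j < n \<Longrightarrow> mm n Q' Q i j = identity_matrix R i j"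
    using general_linearE[OF assms(2)] by blast
  show ?thesis
    using P Q by (intro general_linearI[of _ _ "mm n Q' P'"] mm_closed mm_mult_inverse)
qed

lemma general_linear_transposed:
  assumes "P \<in> general_linear R n"
  shows "transposed P \<in> general_linear R n"
proof -
  obtain P' where P: "P \<in> matrices R n n" "P' \<in> matrices R n n"
    "\<And>i j. i < n \<Longrightarrow> j < n \<Longrightarrow> mm n P P' i j = identity_matrix R i j"
    "\<And>i j. i < n \<Longrightarrow> j < n \<Longrightarrow> mm n P' P i j = identity_matrix R i j"
    using general_linearE[OF assms] by blast
  show ?thesis
    using P by (intro general_linearI[of _ _ "transposed P'"] transposed_closed)
      (auto simp: mm_transposed[of _ n _ _ n] identity_matrix_def)
qed

lemma block_diag_closed:
  assumes "X \<in> matrices R r c" "Y \<in> matrices R r' c'"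
  shows "block_diag R r c X Y \<in> matrices R (r + r') (c + c')"
  using assms[THEN matricesD] by (intro matricesI) (auto simp: block_diag_def)

text \<open>Splitting the inner sum at \<open>k\<close>, the first half vanishes unless the entry
  lies in the upper left block, the second unless it lies in the lower right one.\<close>

lemma mm_block_diag:
  assumes "X \<in> matrices R r k" "X' \<in> matrices R k c" "Y \<in> matrices R r' l" "Y' \<in> matrices R l c'"
    and ij: "i < r + r'" "j < c + c'"
  shows "mm (k + l) (block_diag R r k X Y) (block_diag R k c X' Y') i j =
    block_diag R r c (mm k X X') (mm l Y Y') i j"
proof -
  note c = assms(1-4)[THEN matricesD] ij
  note B = block_diag_closed[OF assms(1,3), THEN matricesD] block_diag_closed[OF assms(2,4), THEN matricesD]
  have "mm (k + l) (block_diag R r k X Y) (block_diag R k c X' Y') i j =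
    (\<Oplus>x\<in>{..<k}. block_diag R r k X Y i x \<otimes> block_diag R k c X' Y' x j) \<oplus>
    (\<Oplus>x\<in>{..<l}. block_diag R r k X Y i (k + x) \<otimes> block_diag R k c X' Y' (k + x) j)"
    unfolding matrix_mult_def using B ij by (intro finsum_lessThan_add) auto
  also have "(\<Oplus>x\<in>{..<k}. block_diag R r k X Y i x \<otimes> block_diag R k c X' Y' x j) =
      (if i < r \<and> j < c then mm k X X' i j else \<zero>)"
    unfolding matrix_mult_def using c
    by (auto simp: block_diag_def intro!: finsum_lessThan_cong finsum_lessThan_zero)
  also have "(\<Oplus>x\<in>{..<l}. block_diag R r k X Y i (k + x) \<otimes> block_diag R k c X' Y' (k + x) j) =
      (if r \<le> i \<and> c \<le> j then mm l Y Y' (i - r) (j - c) else \<zero>)"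
    unfolding matrix_mult_def using c
    by (auto simp: block_diag_def intro!: finsum_lessThan_cong finsum_lessThan_zero)
  also have "(if i < r \<and> j < c then mm k X X' i j else \<zero>) \<oplus>
      (if r \<le> i \<and> c \<le> j then mm l Y Y' (i - r) (j - c) else \<zero>) =
      block_diag R r c (mm k X X') (mm l Y Y') i j"
    using mm_closed[OF assms(1,2), THEN matricesD, of i j]
      mm_closed[OF assms(3,4), THEN matricesD, of "i - r" "j - c"] ij
    by (auto simp: block_diag_def)
  finally show ?thesis .
qed

lemma general_linear_block_diag:
  assumes "P \<in> general_linear R m" "Q \<in> general_linear R n"
  shows "block_diag R m m P Q \<in> general_linear R (m + n)"
proof -
  obtain P' where P: "P \<in> matrices R m m" "P' \<in> matrices R m m"
    "\<And>i j. i < m \<Longrightarrow> j < m \<Longrightarrow> mm m P P' i j = identity_matrix R i j"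
    "\<And>i j. i < m \<Longrightarrow> j < m \<Longrightarrow> mm m P' P i j = identity_matrix R i j"
    using general_linearE[OF assms(1)] by blast
  obtain Q' where Q: "Q \<in> matrices R n n" "Q' \<in> matrices R n n"
    "\<And>i j. i < n \<Longrightarrow> j < n \<Longrightarrow> mm n Q Q' i j = identity_matrix R i j"
    "\<And>i j. i < n \<Longrightarrow> j < n \<Longrightarrow> mm n Q' Q i j = identity_matrix R i j"
    using general_linearE[OF assms(2)] by blast
  show ?thesis
  proof (rule general_linearI)
    fix i j assume ij: "i < m + n" "j < m + n"
    show "mm (m + n) (block_diag R m m P Q) (block_diag R m m P' Q') i j = identity_matrix R i j"
      using P Q ij by (subst mm_block_diag[of _ m m _ m _ n n _ n])
        (auto simp: block_diag_def, auto simp: identity_matrix_def)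
    show "mm (m + n) (block_diag R m m P' Q') (block_diag R m m P Q) i j = identity_matrix R i j"
      using P Q ij by (subst mm_block_diag[of _ m m _ m _ n n _ n])
        (auto simp: block_diag_def, auto simp: identity_matrix_def)
  qed (use P Q in \<open>auto intro: block_diag_closed\<close>)
qed

lemma first_row_adder_closed:
  assumes "\<And>i. i < m \<Longrightarrow> v i \<in> carrier R"
  shows "first_row_adder R v \<in> matrices R m n"
  using assms by (intro matricesI) (auto simp: first_row_adder_def identity_matrix_def)

lemma mm_first_row_adder:
  assumes v: "\<And>i. i < m \<Longrightarrow> v i \<in> carrier R" and A: "A \<in> matrices R m n" and ij: "i < m" "j < n"
  shows "mm m (first_row_adder R v) A i j = A i j \<oplus> v i \<otimes> A 0 j"
proof -
  note c = matricesD[OF A] matricesD[OF identity_matrix_closed[of m m]] v ij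
  have "mm m (first_row_adder R v) A i j =
      (\<Oplus>l\<in>{..<m}. identity_matrix R i l \<otimes> A l j \<oplus> v i \<otimes> (identity_matrix R 0 l \<otimes> A l j))"
    unfolding matrix_mult_def first_row_adder_def using c
    by (intro finsum_lessThan_cong) (auto simp: l_distr m_assoc)
  also have "\<dots> = mm m (identity_matrix R) A i j \<oplus> v i \<otimes> mm m (identity_matrix R) A 0 j"
    unfolding matrix_mult_def using c
    by (subst finsum_lessThan_plus) (auto simp: finsum_lessThan_rdistr)
  finally show ?thesis
    using mm_identity_left[OF A] ij by simp
qed

text \<open>As \<open>v 0 = \<zero>\<close>, row 0 is unchanged by the operation, so adding the
  multiples with coefficients \<open>\<ominus> v i\<close> undoes it.\<close>

lemma general_linear_first_row_adder:
  assumes v: "\<And>i. i < m \<Longrightarrow> v i \<in> carrier R" and v0: "v 0 = \<zero>"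
  shows "first_row_adder R v \<in> general_linear R m"
proof (rule general_linearI)
  have w: "\<And>i. i < m \<Longrightarrow> \<ominus> v i \<in> carrier R" using v by simp
  show c: "first_row_adder R v \<in> matrices R m m" "first_row_adder R (\<lambda>i. \<ominus> v i) \<in> matrices R m m"
    using v by (auto intro!: first_row_adder_closed)
  fix i j assume ij: "i < m" "j < m"
  have e: "identity_matrix R x y \<in> carrier R" for x y by (simp add: identity_matrix_def)
  show "mm m (first_row_adder R v) (first_row_adder R (\<lambda>i. \<ominus> v i)) i j = identity_matrix R i j"
    using v v0 ij e[of i j] e[of 0 j] 
    by (subst mm_first_row_adder[OF v c(2) ij])
      (simp_all add: first_row_adder_def identity_matrix_def l_neg)
  show "mm m (first_row_adder R (\<lambda>i. \<ominus> v i)) (first_row_adder R v) i j = identity_matrix R i j"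
    using v v0 ij e[of i j] e[of 0 j] 
    by (subst mm_first_row_adder[OF w c(1) ij])
      (simp_all add: first_row_adder_def identity_matrix_def r_neg)
qed

text \<open>By induction the tail of the row is \<open>g\<close> times the first row of an
  invertible \<open>P\<close>. If \<open>p 0 = h a\<close> and \<open>g = h b\<close>, the whole row
  is \<open>h\<close> times \<open>(a, b P 0)\<close>, which is the first row of a product of two
  block matrices: one completes \<open>(a, b)\<close>, the other contains \<open>P\<close>.\<close>

lemma row_multiple_of_invertible:
  assumes H: gcd_property
  shows "(\<And>j. j \<le> n \<Longrightarrow> p j \<in> carrier R) \<Longrightarrow>
    \<exists>P\<in>general_linear R (Suc n). \<exists>g\<in>carrier R. \<forall>j\<le>n. p j = g \<otimes> P 0 j"
proof (induction n arbitrary: p)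
  case 0
  then show ?case
    using general_linear_identity
    by (intro bexI[of _ "identity_matrix R"] bexI[of _ "p 0"]) (auto simp: identity_matrix_def)
next
  case (Suc n)
  obtain P g where P: "P \<in> general_linear R (Suc n)" and g: "g \<in> carrier R"
    and Pg: "\<And>j. j \<le> n \<Longrightarrow> p (Suc j) = g \<otimes> P 0 j"
    using Suc.IH[of "\<lambda>j. p (Suc j)"] Suc.prems by auto
  note Pc = general_linear_closed[OF P, THEN matricesD]
  have p0: "p 0 \<in> carrier R" using Suc.prems by simp
  obtain h a b x y where h: "h \<in> carrier R" "a \<in> carrier R" "b \<in> carrier R" "x \<in> carrier R" "y \<in> carrier R"
    "p 0 = h \<otimes> a" "g = h \<otimes> b" "a \<otimes> x \<oplus> b \<otimes> y = \<one>"
    using gcd_propertyE[OF H p0 g] .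
  \<comment> \<open>\<open>E\<close> completes \<open>(a, b)\<close> to determinant 1 by means of
    the Bezout coefficients, and \<open>F\<close> is its adjugate, hence its inverse.\<close>
  define E where "E = (\<lambda>(i :: nat) (j :: nat). if i = 0 then if j = 0 then a else b else if j = 0 then \<ominus> y else x)"
  define F where "F = (\<lambda>(i :: nat) (j :: nat). if i = 0 then if j = 0 then x else \<ominus> b else if j = 0 then y else a)"
  have two: "{..<2::nat} = {..<Suc (Suc 0)}" by auto
  have mm2: "mm 2 X Y i j = X i 0 \<otimes> Y 0 j \<oplus> X i 1 \<otimes> Y 1 j"
    if "X \<in> matrices R 2 2" "Y \<in> matrices R 2 2" "i < 2" "j < 2" for X Y i j
    unfolding matrix_mult_def two using that(1,2)[THEN matricesD] that(3,4)
    by (simp add: finsum_lessThan_Suc)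
  have EF: "E \<in> matrices R 2 2" "F \<in> matrices R 2 2"
    using h by (auto intro!: matricesI simp: E_def F_def)
  have id: "x \<otimes> a \<oplus> \<ominus> b \<otimes> \<ominus> y = \<one>" "\<ominus> y \<otimes> \<ominus> b \<oplus> x \<otimes> a = \<one>" "y \<otimes> b \<oplus> a \<otimes> x = \<one>"
    "a \<otimes> \<ominus> b \<oplus> b \<otimes> a = \<zero>" "\<ominus> y \<otimes> x \<oplus> x \<otimes> y = \<zero>" "x \<otimes> b \<oplus> \<ominus> b \<otimes> x = \<zero>" "y \<otimes> a \<oplus> a \<otimes> \<ominus> y = \<zero>"
    unfolding h(8)[symmetric] using h(2-5) by algebra+
  have "E \<in> general_linear R 2"
  proof (rule general_linearI[OF EF])
    fix i j :: nat assume ij: "i < 2" "j < 2"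
    then have "i = 0 \<or> i = 1" "j = 0 \<or> j = 1" by auto
    then show "mm 2 E F i j = identity_matrix R i j" "mm 2 F E i j = identity_matrix R i j"
      unfolding mm2[OF EF ij] mm2[OF EF(2,1) ij]
      by (auto simp: E_def F_def identity_matrix_def id h(8))
  qed
  then have B1: "block_diag R 2 2 E (identity_matrix R) \<in> general_linear R (Suc (Suc n))"
    using general_linear_block_diag[OF _ general_linear_identity, of E 2 n] by simp
  have B2: "block_diag R 1 1 (identity_matrix R) P \<in> general_linear R (Suc (Suc n))"
    using general_linear_block_diag[OF general_linear_identity P, of 1] by simp
  let ?B1 = "block_diag R 2 2 E (identity_matrix R)" and ?B2 = "block_diag R 1 1 (identity_matrix R) P"
  note Bc = B1[THEN general_linear_closed, THEN matricesD] B2[THEN general_linear_closed, THEN matricesD]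
  \<comment> \<open>Row 0 of the left factor is \<open>(a, b, 0, ..., 0)\<close>, so only rows 0 and
    1 of the right factor contribute; these are \<open>(1, 0, ..., 0)\<close> and \<open>P 0\<close>
    preceded by a zero.\<close>
  have row: "mm (Suc (Suc n)) ?B1 ?B2 0 j = a \<otimes> ?B2 0 j \<oplus> b \<otimes> ?B2 1 j" if "j \<le> Suc n" for j
  proof -
    have "mm (2 + n) ?B1 ?B2 0 j =
        (\<Oplus>l\<in>{..<2}. ?B1 0 l \<otimes> ?B2 l j) \<oplus> (\<Oplus>l\<in>{..<n}. ?B1 0 (2 + l) \<otimes> ?B2 (2 + l) j)"
      unfolding matrix_mult_def using Bc that by (intro finsum_lessThan_add) auto
    also have "(\<Oplus>l\<in>{..<n}. ?B1 0 (2 + l) \<otimes> ?B2 (2 + l) j) = \<zero>"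
      using Bc that by (intro finsum_lessThan_zero) (simp add: block_diag_def[of R 2 2])
    also have "(\<Oplus>l\<in>{..<2}. ?B1 0 l \<otimes> ?B2 l j) = ?B1 0 0 \<otimes> ?B2 0 j \<oplus> ?B1 0 1 \<otimes> ?B2 1 j"
      unfolding two using Bc that by (simp add: finsum_lessThan_Suc)
    also have "?B1 0 0 = a" by (simp add: block_diag_def E_def)
    also have "?B1 0 1 = b" by (simp add: block_diag_def E_def)
    finally show ?thesis using Bc(2)[of 0 j] Bc(2)[of 1 j] h(2,3) that by simp
  qed
  show ?case
  proof (intro bexI[of _ "mm (Suc (Suc n)) ?B1 ?B2"] bexI[of _ h] allI impI)
    fix j assume j: "j \<le> Suc n"
    show "p j = h \<otimes> mm (Suc (Suc n)) ?B1 ?B2 0 j"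
    proof (cases j)
      case 0
      then show ?thesis unfolding row[OF j] using h by (simp add: block_diag_def identity_matrix_def)
    next
      case (Suc i)
      then show ?thesis unfolding row[OF j] using h Pg[of i] Pc[of 0 i] j
        by (simp add: block_diag_def m_assoc)
    qed
  qed (use h general_linear_mult[OF B1 B2] in auto)
qed

end

section \<open>Equivalent matrices and values dividing all entries\<close>

definition equivalent_matrices ::
  "('a, 'm) ring_scheme \<Rightarrow> nat \<Rightarrow> nat \<Rightarrow> (nat \<Rightarrow> nat \<Rightarrow> 'a) \<Rightarrow> (nat \<Rightarrow> nat \<Rightarrow> 'a) \<Rightarrow> bool" where
  "equivalent_matrices R m n A B \<longleftrightarrow>
    (\<exists>P\<in>general_linear R m. \<exists>Q\<in>general_linear R n.
      \<forall>i<m. \<forall>j<n. matrix_mult R n (matrix_mult R m P A) Q i j = B i j)"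

text \<open>A value is a linear combination of the entries, so one that divides them all generates
  the ideal of the entries. Row and column vectors are encoded as matrices with one row or one
  column.\<close>

definition value_divides_entries :: "('a, 'm) ring_scheme \<Rightarrow> nat \<Rightarrow> nat \<Rightarrow> bool" where
  "value_divides_entries R m n \<longleftrightarrow>
    (\<forall>A\<in>matrices R m n. \<exists>p\<in>matrices R 1 m. \<exists>q\<in>matrices R n 1.
      \<forall>i<m. \<forall>j<n. matrix_mult R n (matrix_mult R m p A) q 0 0 divides\<^bsub>R\<^esub> A i j)"

context cring
begin

lemma equivalent_matrices_trans:
  assumes A: "A \<in> matrices R m n"
    and "equivalent_matrices R m n A B" "equivalent_matrices R m n B C"
  shows "equivalent_matrices R m n A C"
proof -
  obtain P Q where P: "P \<in> general_linear R m" "Q \<in> general_linear R n"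
    and B: "\<And>i j. i < m \<Longrightarrow> j < n \<Longrightarrow> mm n (mm m P A) Q i j = B i j"
    using assms(2) unfolding equivalent_matrices_def by blast
  obtain P' Q' where P': "P' \<in> general_linear R m" "Q' \<in> general_linear R n"
    and C: "\<And>i j. i < m \<Longrightarrow> j < n \<Longrightarrow> mm n (mm m P' B) Q' i j = C i j"
    using assms(3) unfolding equivalent_matrices_def by blast
  note c = P[THEN general_linear_closed] P'[THEN general_linear_closed] A
  have PA: "mm m P A \<in> matrices R m n" "mm n (mm m P A) Q \<in> matrices R m n"
    "mm m P' P \<in> matrices R m m" "mm m (mm m P' P) A \<in> matrices R m n"
    using c by (auto intro!: mm_closed)
  have Bc: "B \<in> matrices R m n"
    using PA(2)[THEN matricesD] B by (intro matricesI) auto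
  have "mm n (mm m (mm m P' P) A) (mm n Q Q') i j = C i j" if ij: "i < m" "j < n" for i j
  proof -
    have "mm n (mm m (mm m P' P) A) (mm n Q Q') i j = mm n (mm n (mm m (mm m P' P) A) Q) Q' i j"
      using c PA ij by (intro mm_assoc[symmetric])
    also have "\<dots> = mm n (mm m P' B) Q' i j"
    proof (rule mm_cong)
      fix l assume l: "l < n"
      have "mm n (mm m (mm m P' P) A) Q i l = mm n (mm m P' (mm m P A)) Q i l"
        using c PA ij l by (intro mm_cong[OF mm_closed] mm_assoc) auto
      also have "\<dots> = mm m P' (mm n (mm m P A) Q) i l"
        using c PA ij l by (intro mm_assoc)
      also have "\<dots> = mm m P' B i l"
        using c Bc B ij l by (intro mm_cong) auto
      finally show "mm n (mm m (mm m P' P) A) Q i l = mm m P' B i l" .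
    qed (use c Bc ij in \<open>auto intro: mm_closed\<close>)
    finally show ?thesis using C ij by simp
  qed
  then show ?thesis
    using general_linear_mult[OF P'(1) P(1)] general_linear_mult[OF P(2) P'(2)]
    unfolding equivalent_matrices_def by blast
qed

text \<open>Extending the transforming matrices by an identity block leaves \<open>X\<close> alone,
  so reduction can continue inside the lower right block.\<close>

lemma equivalent_matrices_block_diag:
  assumes X: "X \<in> matrices R k k" and A: "A \<in> matrices R m n" and "equivalent_matrices R m n A B"
  shows "equivalent_matrices R (k + m) (k + n) (block_diag R k k X A) (block_diag R k k X B)"
proof -
  obtain P Q where P: "P \<in> general_linear R m" "Q \<in> general_linear R n"
    and B: "\<And>i j. i < m \<Longrightarrow> j < n \<Longrightarrow> mm n (mm m P A) Q i j = B i j"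
    using assms(3) unfolding equivalent_matrices_def by blast
  note c = P[THEN general_linear_closed] X A mm_closed[OF general_linear_closed[OF P(1)] A]
    identity_matrix_closed[of k k] mm_closed[OF identity_matrix_closed X]
  let ?I = "identity_matrix R"
  have "mm (k + n) (mm (k + m) (block_diag R k k ?I P) (block_diag R k k X A)) (block_diag R k k ?I Q) i j
      = block_diag R k k X B i j" if ij: "i < k + m" "j < k + n" for i j
  proof -
    have "mm (k + n) (mm (k + m) (block_diag R k k ?I P) (block_diag R k k X A)) (block_diag R k k ?I Q) i j
      = mm (k + n) (block_diag R k k (mm k ?I X) (mm m P A)) (block_diag R k k ?I Q) i j"
      using c ij by (intro mm_cong[OF block_diag_closed block_diag_closed] mm_block_diag) auto
    also have "\<dots> = block_diag R k k (mm k (mm k ?I X) ?I) (mm n (mm m P A) Q) i j"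
      using c ij by (intro mm_block_diag) auto
    also have "\<dots> = block_diag R k k X B i j"
      using B ij mm_identity_left[OF X] mm_identity_right[OF mm_closed[OF identity_matrix_closed X]]
      by (auto simp: block_diag_def)
    finally show ?thesis .
  qed
  then show ?thesis
    using general_linear_block_diag[OF general_linear_identity P(1), of k]
      general_linear_block_diag[OF general_linear_identity P(2), of k]
    unfolding equivalent_matrices_def by blast
qed

lemma divides_mm_left:
  assumes "P \<in> matrices R m k" "A \<in> matrices R k n" "d \<in> carrier R"
    "\<And>i j. i < k \<Longrightarrow> j < n \<Longrightarrow> d divides A i j" "i < m" "j < n"
  shows "d divides mm k P A i j"
  unfolding matrix_mult_def using assms(3-) assms(1,2)[THEN matricesD]
  by (intro divides_finsum divides_mult) auto

lemma divides_mm_right: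
  assumes "A \<in> matrices R m k" "Q \<in> matrices R k n" "d \<in> carrier R"
    "\<And>i j. i < m \<Longrightarrow> j < k \<Longrightarrow> d divides A i j" "i < m" "j < n"
  shows "d divides mm k A Q i j"
  unfolding matrix_mult_def using assms(3-) assms(1,2)[THEN matricesD]
  by (intro divides_finsum divides_mult) auto

lemma finsum_lessThan_2:
  "f 0 \<in> carrier R \<Longrightarrow> f 1 \<in> carrier R \<Longrightarrow> (\<Oplus>l\<in>{..<2::nat}. f l) = f 0 \<oplus> f 1"
  using finsum_lessThan_Suc[of "Suc 0" f] finsum_lessThan_Suc[of 0 f]
  by (auto simp: less_Suc_eq numeral_2_eq_2)

lemma value_divides_entries_2_2:
  assumes H: gcd_property and ad: "adequate_range_1 (localization R (loc_stable_range_1_set R))"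
  shows "value_divides_entries R 2 2"
  unfolding value_divides_entries_def
proof
  fix A assume A: "A \<in> matrices R 2 2"
  have c: "A 0 0 \<in> carrier R" "A 0 1 \<in> carrier R" "A 1 0 \<in> carrier R" "A 1 1 \<in> carrier R"
    using matricesD[OF A] by auto
  obtain t where t: "t \<in> carrier R" "represents R (A 0 0) (A 0 1) (A 1 0) (A 1 1) t"
    "t divides A 0 0" "t divides A 0 1" "t divides A 1 0" "t divides A 1 1"
    using represents_common_divisor[OF H ad c] .
  obtain p p' q q' where p: "p \<in> carrier R" "p' \<in> carrier R" "q \<in> carrier R" "q' \<in> carrier R"
    "p \<otimes> (A 0 0 \<otimes> q \<oplus> A 0 1 \<otimes> q') \<oplus> p' \<otimes> (A 1 0 \<otimes> q \<oplus> A 1 1 \<otimes> q') = t"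
    using t(2) unfolding represents_def by blast
  let ?p = "\<lambda>(i::nat) (j::nat). if j = 0 then p else p'"
  let ?q = "\<lambda>(i::nat) (j::nat). if i = 0 then q else q'"
  have pA: "mm 2 ?p A 0 j = p \<otimes> A 0 j \<oplus> p' \<otimes> A 1 j" if "j < 2" for j
    unfolding matrix_mult_def using p c matricesD[OF A] that by (subst finsum_lessThan_2) auto
  have "mm 2 (mm 2 ?p A) ?q 0 0 = mm 2 ?p A 0 0 \<otimes> q \<oplus> mm 2 ?p A 0 1 \<otimes> q'"
    unfolding matrix_mult_def[of R 2 "mm 2 ?p A"] using p c pA by (subst finsum_lessThan_2) auto
  also have "\<dots> = (p \<otimes> A 0 0 \<oplus> p' \<otimes> A 1 0) \<otimes> q \<oplus> (p \<otimes> A 0 1 \<oplus> p' \<otimes> A 1 1) \<otimes> q'"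
    by (simp add: pA)
  also have "\<dots> = t"
    unfolding p(5)[symmetric] using p(1-4) c by algebra
  finally have v: "mm 2 (mm 2 ?p A) ?q 0 0 = t" .
  show "\<exists>p\<in>matrices R 1 2. \<exists>q\<in>matrices R 2 1. \<forall>i<2. \<forall>j<2. mm 2 (mm 2 p A) q 0 0 divides A i j"
  proof (rule bexI[of _ ?p], rule bexI[of _ ?q], intro allI impI)
    fix i j :: nat assume "i < 2" "j < 2"
    then have "i = 0 \<or> i = 1" "j = 0 \<or> j = 1" by auto
    then show "mm 2 (mm 2 ?p A) ?q 0 0 divides A i j" unfolding v using t by auto
  qed (use p in \<open>auto intro!: matricesI\<close>)
qed

text \<open>Induction on the number of columns. The column \<open>A q\<close> stands in for the
  first \<open>n\<close> columns, and together with the last column it forms a 2 by 2 matrix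
  \<open>?C\<close>. A value of \<open>?C\<close> dividing its entries divides \<open>p A q\<close>,
  hence everything that \<open>p A q\<close> divides.\<close>

lemma value_divides_entries_two_rows:
  assumes D: "value_divides_entries R 2 2"
  shows "value_divides_entries R 2 n"
proof (induction n)
  case 0
  then show ?case
    unfolding value_divides_entries_def
    using identity_matrix_closed by blast
next
  case (Suc n)
  show ?case
    unfolding value_divides_entries_def
  proof
    fix A assume A: "A \<in> matrices R 2 (Suc n)"
    then have A': "A \<in> matrices R 2 n" unfolding matrices_def by auto
    obtain p q where p: "p \<in> matrices R 1 2" "q \<in> matrices R n 1"
      and "\<forall>i<2. \<forall>j<n. mm n (mm 2 p A) q 0 0 divides A i j"
      using Suc.IH A' unfolding value_divides_entries_def by blast
    note e = this(3)[rule_format]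
    let ?C = "\<lambda>(i::nat) (j::nat). if j = 0 then mm n A q i 0 else A i n"
    have Aq: "mm n A q \<in> matrices R 2 1" using A' p by (intro mm_closed)
    have C: "?C \<in> matrices R 2 2"
      using matricesD[OF A] matricesD[OF Aq] by (intro matricesI) auto
    obtain p' q' where p': "p' \<in> matrices R 1 2" "q' \<in> matrices R 2 1"
      and "\<forall>i<2. \<forall>j<2. mm 2 (mm 2 p' ?C) q' 0 0 divides ?C i j"
      using D C unfolding value_divides_entries_def by blast
    note e' = this(3)[rule_format]
    let ?d = "mm 2 (mm 2 p' ?C) q' 0 0"
    have d: "?d \<in> carrier R"
      using mm_closed[OF mm_closed[OF p'(1) C] p'(2), THEN matricesD] by simp
    \<comment> \<open>\<open>r\<close> is chosen so that \<open>A r = ?C q'\<close>: the first entry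
      of \<open>q'\<close> is spread over the first \<open>n\<close> columns by \<open>q\<close>,
      the second goes to the last column.\<close>
    define r where "r = (\<lambda>j i. if j < n then q j 0 \<otimes> q' 0 i else q' 1 i)"
    have r: "r \<in> matrices R (Suc n) 1"
      unfolding r_def using matricesD[OF p(2)] matricesD[OF p'(2)] by (intro matricesI) auto
    have Ar: "mm (Suc n) A r i 0 = mm 2 ?C q' i 0" if i: "i < 2" for i
    proof -
      have "mm (Suc n) A r i 0 = (\<Oplus>l\<in>{..<n}. A i l \<otimes> r l 0) \<oplus> A i n \<otimes> r n 0"
        unfolding matrix_mult_def using matricesD[OF A] matricesD[OF r] i
        by (intro finsum_lessThan_Suc) auto
      also have "(\<Oplus>l\<in>{..<n}. A i l \<otimes> r l 0) = mm n A q i 0 \<otimes> q' 0 0"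
        unfolding matrix_mult_def using matricesD[OF A] matricesD[OF p(2)] matricesD[OF p'(2)] i
        by (subst finsum_lessThan_ldistr) (auto simp: r_def m_assoc intro!: finsum_lessThan_cong)
      also have "mm n A q i 0 \<otimes> q' 0 0 \<oplus> A i n \<otimes> r n 0 = mm 2 ?C q' i 0"
        unfolding matrix_mult_def[of R 2] using matricesD[OF A] matricesD[OF Aq] matricesD[OF p'(2)] i
        by (subst finsum_lessThan_2) (auto simp: r_def)
      finally show ?thesis .
    qed
    have "mm (Suc n) (mm 2 p' A) r 0 0 = mm 2 p' (mm (Suc n) A r) 0 0"
      using p' A r by (intro mm_assoc) auto
    also have "\<dots> = mm 2 p' (mm 2 ?C q') 0 0"
      using p' C Ar by (intro mm_cong[of _ 1 _ _ 1] mm_closed) auto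
    also have "\<dots> = ?d"
      using p' C by (intro mm_assoc[symmetric]) auto
    finally have v: "mm (Suc n) (mm 2 p' A) r 0 0 = ?d" .
    have "mm n (mm 2 p A) q 0 0 = mm 2 p (mm n A q) 0 0"
      using p A' by (intro mm_assoc) auto
    \<comment> \<open>The old row \<open>p\<close> does not enter the new value; it only transfers
      divisibility from the column \<open>A q\<close> to the value \<open>p A q\<close>.\<close>
    moreover have "?d divides mm 2 p (mm n A q) 0 0"
    proof (rule divides_mm_left[OF p(1) Aq d])
      fix i j :: nat assume "i < 2" "j < 1"
      then show "?d divides mm n A q i j" using e'[of i 0] by simp
    qed auto
    ultimately have de: "?d divides mm n (mm 2 p A) q 0 0" by simp
    show "\<exists>p\<in>matrices R 1 2. \<exists>q\<in>matrices R (Suc n) 1. \<forall>i<2. \<forall>j<Suc n.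
        mm (Suc n) (mm 2 p A) q 0 0 divides A i j"
    proof (intro bexI[OF _ p'(1)] bexI[OF _ r] allI impI)
      fix i j assume ij: "i < (2::nat)" "j < Suc n"
      show "mm (Suc n) (mm 2 p' A) r 0 0 divides A i j"
      proof (cases "j < n")
        case True
        then show ?thesis unfolding v using divides_trans[OF de e d] ij by blast
      next
        case False
        then have "j = n" using ij by simp
        then show ?thesis unfolding v using e'[of i 1] ij by simp
      qed
    qed
  qed
qed

text \<open>The same compression applied to rows: \<open>p A\<close> stands in for the first
  \<open>m\<close> rows, and stacking it on the last row gives a matrix with two rows, so the case
  of two rows and \<open>n\<close> columns drives the induction.\<close>

lemma value_divides_entries_all:
  assumes D: "value_divides_entries R 2 n"
  shows "value_divides_entries R m n"
proof (induction m)
  case 0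
  then show ?case
    unfolding value_divides_entries_def
    using identity_matrix_closed by blast
next
  case (Suc m)
  show ?case
    unfolding value_divides_entries_def
  proof
    fix A assume A: "A \<in> matrices R (Suc m) n"
    then have A': "A \<in> matrices R m n" unfolding matrices_def by auto
    obtain p q where p: "p \<in> matrices R 1 m" "q \<in> matrices R n 1"
      and "\<forall>i<m. \<forall>j<n. mm n (mm m p A) q 0 0 divides A i j"
      using Suc.IH A' unfolding value_divides_entries_def by blast
    note e = this(3)[rule_format]
    let ?C = "\<lambda>(i::nat) (j::nat). if i = 0 then mm m p A 0 j else A m j"
    have pA: "mm m p A \<in> matrices R 1 n" using A' p by (intro mm_closed)
    have C: "?C \<in> matrices R 2 n"
      using matricesD[OF A] matricesD[OF pA] by (intro matricesI) auto
    obtain p' q' where p': "p' \<in> matrices R 1 2" "q' \<in> matrices R n 1"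
      and "\<forall>i<2. \<forall>j<n. mm n (mm 2 p' ?C) q' 0 0 divides ?C i j"
      using D C unfolding value_divides_entries_def by blast
    note e' = this(3)[rule_format]
    let ?d = "mm n (mm 2 p' ?C) q' 0 0"
    have d: "?d \<in> carrier R"
      using mm_closed[OF mm_closed[OF p'(1) C] p'(2), THEN matricesD] by simp
    define r where "r = (\<lambda>j i. if i < m then p' j 0 \<otimes> p 0 i else p' j 1)"
    have r: "r \<in> matrices R 1 (Suc m)"
      unfolding r_def using matricesD[OF p(1)] matricesD[OF p'(1)] by (intro matricesI) auto
    have rA: "mm (Suc m) r A 0 j = mm 2 p' ?C 0 j" if j: "j < n" for j
    proof -
      have "mm (Suc m) r A 0 j = (\<Oplus>l\<in>{..<m}. r 0 l \<otimes> A l j) \<oplus> r 0 m \<otimes> A m j"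
        unfolding matrix_mult_def using matricesD[OF A] matricesD[OF r] j
        by (intro finsum_lessThan_Suc) auto
      also have "(\<Oplus>l\<in>{..<m}. r 0 l \<otimes> A l j) = p' 0 0 \<otimes> mm m p A 0 j"
        unfolding matrix_mult_def using matricesD[OF A] matricesD[OF p(1)] matricesD[OF p'(1)] j
        by (subst finsum_lessThan_rdistr) (auto simp: r_def m_assoc intro!: finsum_lessThan_cong)
      also have "p' 0 0 \<otimes> mm m p A 0 j \<oplus> r 0 m \<otimes> A m j = mm 2 p' ?C 0 j"
        unfolding matrix_mult_def[of R 2] using matricesD[OF A] matricesD[OF pA] matricesD[OF p'(1)] j
        by (subst finsum_lessThan_2) (auto simp: r_def)
      finally show ?thesis .
    qed
    have v: "mm n (mm (Suc m) r A) q' 0 0 = ?d"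
      using p' C rA by (intro mm_cong[of _ 1 _ _ 1] mm_closed) auto
    have de: "?d divides mm n (mm m p A) q 0 0"
    proof (rule divides_mm_right[OF pA p(2) d])
      fix i j assume "i < (1::nat)" "j < n"
      then show "?d divides mm m p A i j" using e'[of 0 j] by simp
    qed auto
    show "\<exists>p\<in>matrices R 1 (Suc m). \<exists>q\<in>matrices R n 1. \<forall>i<Suc m. \<forall>j<n.
        mm n (mm (Suc m) p A) q 0 0 divides A i j"
    proof (intro bexI[OF _ r] bexI[OF _ p'(2)] allI impI)
      fix i j assume ij: "i < Suc m" "j < n"
      show "mm n (mm (Suc m) r A) q' 0 0 divides A i j"
      proof (cases "i < m")
        case True
        then show ?thesis unfolding v using divides_trans[OF de e d] ij by blast
      next
        case False
        then have "i = m" using ij by simp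
        then show ?thesis unfolding v using e'[of 1 j] ij by simp
      qed
    qed
  qed
qed

text \<open>The row is \<open>g\<close> times the first row of an invertible \<open>P\<close>, the
  column \<open>h\<close> times the first column of an invertible \<open>Q\<close>. So the value is
  \<open>g h\<close> times the corner of \<open>B = P A Q\<close>. The corner thus divides the
  value, then all entries of \<open>A\<close>, then all entries of \<open>B\<close>, which are
  combinations of them.\<close>

lemma equivalent_corner_divides:
  assumes H: gcd_property and D: "value_divides_entries R (Suc m) (Suc n)"
    and A: "A \<in> matrices R (Suc m) (Suc n)"
  obtains B where "B \<in> matrices R (Suc m) (Suc n)" "equivalent_matrices R (Suc m) (Suc n) A B"
    "\<And>i j. i < Suc m \<Longrightarrow> j < Suc n \<Longrightarrow> B 0 0 divides B i j"
proof -
  obtain p q where p: "p \<in> matrices R 1 (Suc m)" "q \<in> matrices R (Suc n) 1"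
    and "\<forall>i<Suc m. \<forall>j<Suc n. mm (Suc n) (mm (Suc m) p A) q 0 0 divides A i j"
    using D A unfolding value_divides_entries_def by blast
  note e = this(3)[rule_format]
  obtain P g where P: "P \<in> general_linear R (Suc m)" "g \<in> carrier R" "\<And>j. j \<le> m \<Longrightarrow> p 0 j = g \<otimes> P 0 j"
    using row_multiple_of_invertible[OF H, of m "p 0"] matricesD[OF p(1)] by (auto simp: less_Suc_eq_le)
  obtain Q' h where Q': "Q' \<in> general_linear R (Suc n)" "h \<in> carrier R" "\<And>j. j \<le> n \<Longrightarrow> q j 0 = h \<otimes> Q' 0 j"
    using row_multiple_of_invertible[OF H, of n "\<lambda>j. q j 0"] matricesD[OF p(2)] by (auto simp: less_Suc_eq_le)
  \<comment> \<open>The completion lemma handles rows; transposing turns the completed row into the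
    first column.\<close>
  define Q where "Q = transposed Q'"
  have Q: "Q \<in> general_linear R (Suc n)" unfolding Q_def using Q'(1) by (rule general_linear_transposed)
  define B where "B = mm (Suc n) (mm (Suc m) P A) Q"
  note Pc = general_linear_closed[OF P(1)] and Qc = general_linear_closed[OF Q]
  have PA: "mm (Suc m) P A \<in> matrices R (Suc m) (Suc n)" using Pc A by (intro mm_closed)
  have B: "B \<in> matrices R (Suc m) (Suc n)" unfolding B_def using PA Qc by (rule mm_closed)
  have B00: "B 0 0 \<in> carrier R" using matricesD[OF B] by simp
  have pA: "mm (Suc m) p A 0 j = g \<otimes> mm (Suc m) P A 0 j" if "j < Suc n" for j
    unfolding matrix_mult_def using that P matricesD[OF Pc] matricesD[OF A]
    by (subst finsum_lessThan_rdistr) (auto simp: m_assoc less_Suc_eq_le intro!: finsum_lessThan_cong)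
  have "mm (Suc n) (mm (Suc m) p A) q 0 0 = (\<Oplus>l\<in>{..<Suc n}. (g \<otimes> h) \<otimes> (mm (Suc m) P A 0 l \<otimes> Q l 0))"
    unfolding matrix_mult_def[of R "Suc n"]
    using pA Q'(2,3) P(2) matricesD[OF PA] matricesD[OF Qc]
    by (intro finsum_lessThan_cong) (auto simp: Q_def transposed_def m_ac)
  also have "\<dots> = (g \<otimes> h) \<otimes> B 0 0"
    unfolding B_def matrix_mult_def[of R "Suc n"]
    using Q'(2) P(2) matricesD[OF PA] matricesD[OF Qc]
    by (intro finsum_lessThan_rdistr[symmetric]) auto
  finally have "B 0 0 divides mm (Suc n) (mm (Suc m) p A) q 0 0"
    using B00 P(2) Q'(2) by (auto intro!: dividesI[of "g \<otimes> h"] simp: m_comm)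
  then have "B 0 0 divides A i j" if "i < Suc m" "j < Suc n" for i j
    using divides_trans[OF _ e[OF that] B00] by blast
  then have "B 0 0 divides B i j" if "i < Suc m" "j < Suc n" for i j
    using that A PA Pc Qc B00 by (subst (2) B_def) (intro divides_mm_right divides_mm_left; auto)
  moreover have "equivalent_matrices R (Suc m) (Suc n) A B"
    unfolding equivalent_matrices_def B_def using P(1) Q by blast
  ultimately show ?thesis using that B by blast
qed

text \<open>Every entry is a multiple of the corner, so subtracting multiples of row 0 and then of
  column 0 clears both. The new entries are combinations of the old ones and stay divisible by the
  corner.\<close>

lemma equivalent_clear_first_row_column:
  assumes B: "B \<in> matrices R (Suc m) (Suc n)"
    and dv: "\<And>i j. i < Suc m \<Longrightarrow> j < Suc n \<Longrightarrow> B 0 0 divides B i j"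
  obtains C where "C \<in> matrices R m n" "\<And>i j. i < m \<Longrightarrow> j < n \<Longrightarrow> B 0 0 divides C i j"
    "equivalent_matrices R (Suc m) (Suc n) B (block_diag R 1 1 (\<lambda>i j. B 0 0) C)"
proof -
  have d: "B 0 0 \<in> carrier R" using matricesD[OF B] by simp
  \<comment> \<open>The range conditions stand inside the existential, so the quotients can be
    chosen as a total function with values in the carrier.\<close>
  have "\<forall>i j. \<exists>c\<in>carrier R. i < Suc m \<longrightarrow> j < Suc n \<longrightarrow> B i j = B 0 0 \<otimes> c"
    using dv unfolding factor_def by blast
  then obtain c where c: "\<And>i j. c i j \<in> carrier R"
    "\<And>i j. i < Suc m \<Longrightarrow> j < Suc n \<Longrightarrow> B i j = B 0 0 \<otimes> c i j"
    by metis
  \<comment> \<open>Each multiplier is the negative quotient by the corner; the value zero at index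
    0 keeps row 0 and column 0 in place and makes the operations invertible.\<close>
  define v where "v = (\<lambda>i. if i = 0 then \<zero> else \<ominus> c i 0)"
  define w where "w = (\<lambda>j. if j = 0 then \<zero> else \<ominus> c 0 j)"
  have v: "v i \<in> carrier R" and w: "w i \<in> carrier R" for i using c by (auto simp: v_def w_def)
  have L: "first_row_adder R v \<in> general_linear R (Suc m)" "first_row_adder R w \<in> general_linear R (Suc n)"
    using v w by (auto intro!: general_linear_first_row_adder simp: v_def w_def)
  note Lc = L[THEN general_linear_closed]
  let ?B = "mm (Suc m) (first_row_adder R v) B"
  let ?W = "transposed (first_row_adder R w)"
  let ?C = "mm (Suc n) ?B ?W"
  have B': "?B \<in> matrices R (Suc m) (Suc n)" using Lc B by (intro mm_closed)
  have C': "?C \<in> matrices R (Suc m) (Suc n)" using B' transposed_closed[OF Lc(2)] by (rule mm_closed)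
  have Be: "?B i j = B i j \<oplus> v i \<otimes> B 0 j" if "i < Suc m" "j < Suc n" for i j
    using v B that by (intro mm_first_row_adder)
  have Ce: "?C i j = ?B i j \<oplus> w j \<otimes> ?B i 0" if "i < Suc m" "j < Suc n" for i j
  proof -
    have "?C i j = mm (Suc n) (first_row_adder R w) (transposed ?B) j i"
      using mm_transposed[OF Lc(2) transposed_closed[OF B'], of i j] that by simp
    also have "\<dots> = ?B i j \<oplus> w j \<otimes> ?B i 0"
      using mm_first_row_adder[of "Suc n" w "transposed ?B" "Suc m" j i] transposed_closed[OF B'] w that
      by (simp add: transposed_def)
    finally show ?thesis .
  qed
  have z: "B 0 0 \<otimes> x \<oplus> \<ominus> x \<otimes> B 0 0 = \<zero>" if "x \<in> carrier R" for x
    using that d by algebra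
  have B0: "?B i 0 = (if i = 0 then B 0 0 else \<zero>)" if "i < Suc m" for i
    using Be[OF that, of 0] c(2)[OF that, of 0] c(1) d z by (auto simp: v_def)
  have C0: "?C 0 j = (if j = 0 then B 0 0 else \<zero>)" if "j < Suc n" for j
    using Ce[OF _ that, of 0] Be[OF _ that, of 0] c(2)[OF _ that, of 0] B0[of 0] c(1)[of 0 j] d z
      matricesD[OF B, of 0 j] that
    by (auto simp: v_def w_def)
  have C1: "?C i 0 = (if i = 0 then B 0 0 else \<zero>)" if "i < Suc m" for i
    using Ce[OF that, of 0] B0[OF that] d by (auto simp: w_def)
  have dC: "B 0 0 divides ?C i j" if "i < Suc m" "j < Suc n" for i j
    using that B B' Lc d dv transposed_closed[OF Lc(2)]
    by (intro divides_mm_right divides_mm_left; auto)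
  show ?thesis
  proof (rule that[of "\<lambda>i j. ?C (Suc i) (Suc j)"])
    show "(\<lambda>i j. ?C (Suc i) (Suc j)) \<in> matrices R m n"
      using matricesD[OF C'] by (intro matricesI) auto
    show "B 0 0 divides ?C (Suc i) (Suc j)" if "i < m" "j < n" for i j
      using dC that by simp
    have "?C i j = block_diag R 1 1 (\<lambda>i j. B 0 0) (\<lambda>i j. ?C (Suc i) (Suc j)) i j"
      if "i < Suc m" "j < Suc n" for i j
      using C0[OF that(2)] C1[OF that(1)] by (auto simp: block_diag_def)
    then show "equivalent_matrices R (Suc m) (Suc n) B
        (block_diag R 1 1 (\<lambda>i j. B 0 0) (\<lambda>i j. ?C (Suc i) (Suc j)))"
      using L(1) general_linear_transposed[OF L(2)] unfolding equivalent_matrices_def by blast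
  qed
qed

text \<open>Separating the diagonal matrix from the product that computes it allows equivalences to
  be chained by transitivity.\<close>

lemma admits_diagonal_reduction_iff:
  "admits_diagonal_reduction R m n A \<longleftrightarrow>
    (\<exists>E. equivalent_matrices R m n A E \<and> (\<forall>i<m. \<forall>j<n. i \<noteq> j \<longrightarrow> E i j = \<zero>) \<and>
      (\<forall>i. i + 1 < min m n \<longrightarrow> E i i divides E (i + 1) (i + 1)))"
proof
  assume "admits_diagonal_reduction R m n A"
  then show "\<exists>E. equivalent_matrices R m n A E \<and> (\<forall>i<m. \<forall>j<n. i \<noteq> j \<longrightarrow> E i j = \<zero>) \<and>
      (\<forall>i. i + 1 < min m n \<longrightarrow> E i i divides E (i + 1) (i + 1))"
    unfolding admits_diagonal_reduction_def equivalent_matrices_def Let_def by blast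
next
  assume "\<exists>E. equivalent_matrices R m n A E \<and> (\<forall>i<m. \<forall>j<n. i \<noteq> j \<longrightarrow> E i j = \<zero>) \<and>
      (\<forall>i. i + 1 < min m n \<longrightarrow> E i i divides E (i + 1) (i + 1))"
  then obtain E where "equivalent_matrices R m n A E"
    and E: "\<forall>i<m. \<forall>j<n. i \<noteq> j \<longrightarrow> E i j = \<zero>"
      "\<forall>i. i + 1 < min m n \<longrightarrow> E i i divides E (i + 1) (i + 1)"
    by blast
  then obtain P Q where "P \<in> general_linear R m" "Q \<in> general_linear R n"
    "\<forall>i<m. \<forall>j<n. mm n (mm m P A) Q i j = E i j"
    unfolding equivalent_matrices_def by blast
  then show "admits_diagonal_reduction R m n A"
    unfolding admits_diagonal_reduction_def Let_def using E
    by (intro bexI[of _ P] bexI[of _ Q]) auto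
qed

text \<open>Induction on the number of rows for all column numbers at once: move a common divisor of
  the entries to the corner, clear its row and column, and reduce the remaining block.\<close>

lemma admits_diagonal_reduction_of_value_divides_entries:
  assumes H: gcd_property and D: "\<And>m n. value_divides_entries R m n"
  shows "A \<in> matrices R m n \<Longrightarrow> admits_diagonal_reduction R m n A"
proof (induction m arbitrary: n A)
  case 0
  then show ?case
    unfolding admits_diagonal_reduction_def using general_linear_identity by auto
next
  case (Suc m)
  show ?case
  proof (cases n)
    case 0
    then show ?thesis
      unfolding admits_diagonal_reduction_def using general_linear_identity by auto
  next
    case (Suc k)
    note A = \<open>A \<in> matrices R (Suc m) n\<close>[unfolded Suc]
    obtain B where B: "B \<in> matrices R (Suc m) (Suc k)" "equivalent_matrices R (Suc m) (Suc k) A B"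
      "\<And>i j. i < Suc m \<Longrightarrow> j < Suc k \<Longrightarrow> B 0 0 divides B i j"
      using equivalent_corner_divides[OF H D A] by blast
    obtain C where C: "C \<in> matrices R m k" "\<And>i j. i < m \<Longrightarrow> j < k \<Longrightarrow> B 0 0 divides C i j"
      "equivalent_matrices R (Suc m) (Suc k) B (block_diag R 1 1 (\<lambda>i j. B 0 0) C)"
      using equivalent_clear_first_row_column[OF B(1,3)] by blast
    obtain E where E: "equivalent_matrices R m k C E" "\<And>i j. i < m \<Longrightarrow> j < k \<Longrightarrow> i \<noteq> j \<Longrightarrow> E i j = \<zero>"
      "\<And>i. i + 1 < min m k \<Longrightarrow> E i i divides E (i + 1) (i + 1)"
      using Suc.IH[OF C(1)] unfolding admits_diagonal_reduction_iff by blast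
    have d: "B 0 0 \<in> carrier R" using matricesD[OF B(1)] by simp
    \<comment> \<open>The entries of \<open>E\<close> are combinations of those of \<open>C\<close>,
      so the corner divides them; this is the first link of the divisibility chain, which the
      induction hypothesis does not provide.\<close>
    have dE: "B 0 0 divides E i j" if "i < m" "j < k" for i j
    proof -
      obtain P Q where PQ: "P \<in> general_linear R m" "Q \<in> general_linear R k"
        "\<forall>i<m. \<forall>j<k. mm k (mm m P C) Q i j = E i j"
        using E(1) unfolding equivalent_matrices_def by blast
      note P = PQ(1,2)[THEN general_linear_closed] and e = PQ(3)[rule_format, OF that]
      show ?thesis
        unfolding e[symmetric] using that P C(1,2) d mm_closed[OF P(1) C(1)]
        by (intro divides_mm_right divides_mm_left; auto)
    qed
    let ?F = "block_diag R 1 1 (\<lambda>i j. B 0 0) E"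
    have "equivalent_matrices R (Suc m) (Suc k) (block_diag R 1 1 (\<lambda>i j. B 0 0) C) ?F"
      using equivalent_matrices_block_diag[OF _ C(1) E(1), of "\<lambda>i j. B 0 0" 1] d
      by (auto intro: matricesI)
    then have "equivalent_matrices R (Suc m) (Suc k) A ?F"
      using equivalent_matrices_trans[OF A B(2)] equivalent_matrices_trans[OF B(1) C(3)] by blast
    moreover have "?F i j = \<zero>" if "i < Suc m" "j < Suc k" "i \<noteq> j" for i j
      using that E(2)[of "i - 1" "j - 1"] by (auto simp: block_diag_def)
    \<comment> \<open>For \<open>i = 0\<close> this is \<open>dE\<close>; for larger
      \<open>i\<close> it is the chain of \<open>E\<close> shifted by one.\<close>
    moreover have "?F i i divides ?F (i + 1) (i + 1)" if "i + 1 < min (Suc m) (Suc k)" for i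
      using that E(3)[of "i - 1"] dE[of 0 0] by (cases i) (auto simp: block_diag_def)
    ultimately show ?thesis
      unfolding Suc admits_diagonal_reduction_iff by blast
  qed
qed

text \<open>Multiplying \<open>(a, b) Q = (c, 0)\<close> by the inverse \<open>Q'\<close> gives
  \<open>(a, b) = c\<close> times the first row of \<open>Q'\<close>. The corner entry of
  \<open>Q' Q\<close> is the Bezout identity for that row.\<close>

lemma gcd_property_of_hermite_ring:
  assumes "hermite_ring R"
  shows gcd_property
  unfolding gcd_property_def
proof (intro ballI)
  fix a b assume ab: "a \<in> carrier R" "b \<in> carrier R"
  let ?r = "\<lambda>(i::nat) (j::nat). if j = 0 then a else b"
  obtain Q c where Q: "Q \<in> general_linear R 2" "c \<in> carrier R" "mm 2 ?r Q 0 0 = c" "mm 2 ?r Q 0 1 = \<zero>"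
    using assms ab unfolding hermite_ring_def Let_def by blast
  obtain Q' where Q': "Q \<in> matrices R 2 2" "Q' \<in> matrices R 2 2"
    "\<And>i j. i < 2 \<Longrightarrow> j < 2 \<Longrightarrow> mm 2 Q Q' i j = identity_matrix R i j"
    "\<And>i j. i < 2 \<Longrightarrow> j < 2 \<Longrightarrow> mm 2 Q' Q i j = identity_matrix R i j"
    using general_linearE[OF Q(1)] by blast
  note c = matricesD[OF Q'(1)] matricesD[OF Q'(2)]
  have r: "?r \<in> matrices R 1 2" using ab by (auto intro: matricesI)
  have "?r 0 j = c \<otimes> Q' 0 j" if j: "j < 2" for j
  proof -
    have "?r 0 j = mm 2 ?r (identity_matrix R) 0 j"
      using r j by (subst mm_identity_right) auto
    also have "\<dots> = mm 2 ?r (mm 2 Q Q') 0 j"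
      using r j Q' by (intro mm_cong[symmetric]) auto
    also have "\<dots> = mm 2 (mm 2 ?r Q) Q' 0 j"
      using r j Q' by (intro mm_assoc[symmetric]) auto
    also have "\<dots> = mm 2 ?r Q 0 0 \<otimes> Q' 0 j \<oplus> mm 2 ?r Q 0 1 \<otimes> Q' 1 j"
      unfolding matrix_mult_def[of R 2 "mm 2 ?r Q"] using Q j c
      by (subst finsum_lessThan_2) auto
    also have "\<dots> = c \<otimes> Q' 0 j"
      unfolding Q(3,4) using Q(2) j c by simp
    finally show ?thesis .
  qed
  from this[of 0] this[of 1] have "a = c \<otimes> Q' 0 0" "b = c \<otimes> Q' 0 1" by simp_all
  moreover have "Q' 0 0 \<otimes> Q 0 0 \<oplus> Q' 0 1 \<otimes> Q 1 0 = mm 2 Q' Q 0 0"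
    unfolding matrix_mult_def using c by (subst finsum_lessThan_2) auto
  then have "Q' 0 0 \<otimes> Q 0 0 \<oplus> Q' 0 1 \<otimes> Q 1 0 = \<one>"
    using Q'(4)[of 0 0] by (simp add: identity_matrix_def)
  ultimately show "\<exists>g\<in>carrier R. \<exists>a'\<in>carrier R. \<exists>b'\<in>carrier R. \<exists>x\<in>carrier R. \<exists>y\<in>carrier R.
      a = g \<otimes> a' \<and> b = g \<otimes> b' \<and> a' \<otimes> x \<oplus> b' \<otimes> y = \<one>"
    using Q(2) c(1)[of 0 0] c(1)[of 1 0] c(2)[of 0 0] c(2)[of 0 1] by fastforce
qed

text \<open>The row \<open>(a, b)\<close> is reduced as a 1 by 2 matrix. The left factor is then a 1
  by 1 invertible matrix, that is a unit, and can be cancelled from the vanishing second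
  entry.\<close>

lemma hermite_ring_of_elementary_divisor_ring:
  assumes "elementary_divisor_ring R"
  shows "hermite_ring R"
  unfolding hermite_ring_def Let_def
proof (intro ballI)
  fix a b assume ab: "a \<in> carrier R" "b \<in> carrier R"
  let ?r = "\<lambda>(i::nat) (j::nat). if j = 0 then a else b"
  have r: "?r \<in> matrices R 1 2" using ab by (auto intro: matricesI)
  then have "admits_diagonal_reduction R 1 2 ?r"
    using assms unfolding elementary_divisor_ring_def by blast
  then obtain P Q where P: "P \<in> general_linear R 1" and Q: "Q \<in> general_linear R 2"
    and e: "mm 2 (mm 1 P ?r) Q 0 1 = \<zero>"
    unfolding admits_diagonal_reduction_def Let_def by force
  obtain P' where P': "P \<in> matrices R 1 1" "P' \<in> matrices R 1 1"
    "mm 1 P' P 0 0 = identity_matrix R 0 0"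
    using general_linearE[OF P] by (metis zero_less_one)
  have Qc: "Q \<in> matrices R 2 2" using Q by (rule general_linear_closed)
  have rQ: "mm 2 ?r Q \<in> matrices R 1 2" using r Qc by (rule mm_closed)
  have mm1: "mm 1 X Y 0 j = X 0 0 \<otimes> Y 0 j" if "X 0 0 \<in> carrier R" "Y 0 j \<in> carrier R" for X Y j
    unfolding matrix_mult_def using that finsum_lessThan_Suc[of 0 "\<lambda>l. X 0 l \<otimes> Y l j"] by simp
  have c: "P 0 0 \<in> carrier R" "P' 0 0 \<in> carrier R" "mm 2 ?r Q 0 0 \<in> carrier R" "mm 2 ?r Q 0 1 \<in> carrier R"
    using matricesD[OF P'(1)] matricesD[OF P'(2)] matricesD[OF rQ] by auto
  have "mm 2 (mm 1 P ?r) Q 0 1 = mm 1 P (mm 2 ?r Q) 0 1"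
    using P' r Qc by (intro mm_assoc) auto
  then have "P 0 0 \<otimes> mm 2 ?r Q 0 1 = \<zero>"
    using e mm1[of P "mm 2 ?r Q" 1] c by simp
  moreover have "P' 0 0 \<otimes> P 0 0 = \<one>"
    using P'(3) mm1[of P' P 0] c by (simp add: identity_matrix_def)
  ultimately have "mm 2 ?r Q 0 1 = \<zero>"
    using c by (metis l_one m_assoc r_null)
  then show "\<exists>Q\<in>general_linear R 2. \<exists>c\<in>carrier R. mm 2 ?r Q 0 0 = c \<and> mm 2 ?r Q 0 1 = \<zero>"
    using Q c by blast
qed

end

theorem theorem4p3:
  fixes R :: "('a, 'm) ring_scheme"
  assumes "cring R"
    and "adequate_range_1 (localization R (loc_stable_range_1_set R))"
  shows "elementary_divisor_ring R \<longleftrightarrow> hermite_ring R"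
proof
  interpret cring R by fact
  show "hermite_ring R" if "elementary_divisor_ring R"
    using that by (rule hermite_ring_of_elementary_divisor_ring)
  show "elementary_divisor_ring R" if "hermite_ring R"
  proof -
    have H: gcd_property
      using that by (rule gcd_property_of_hermite_ring)
    \<comment> \<open>Adequate range 1 supplies the 2 by 2 case; larger sizes follow by compressing
      columns and then rows.\<close>
    have "value_divides_entries R m n" for m n
      using value_divides_entries_2_2[OF H assms(2)] value_divides_entries_two_rows
        value_divides_entries_all by blast
    then show ?thesis
      unfolding elementary_divisor_ring_def
      using admits_diagonal_reduction_of_value_divides_entries[OF H] by blast
  qed
qed

end
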